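(* For $0\le k\le n$, the elements of $B_{n,k}$ form a basis of the quantum Russell space $R^q_{n,k}$ as a $\mathbb{Z}[q,q^{-1}]$-module.
   Context: A diagram is a crossingless matching of the points $1,\ldots,2n$ on a line (arcs below the line) with exactly $k$ of its arcs dotted (one dot each). Let $\widetilde R^q_{n,k}$ be the free $\mathbb{Z}[q,q^{-1}]$-module on diagrams, and $R^q_{n,k}$ its quotient by the quantum Type I and II Russell relations. In these, $a<b<c<d$; the diagrams are identical except as indicated; a bar marks a dotted arc; $x_1,\ldots,x_\alpha$ are all undotted arcs $(e,e')$ with $e<a$, $d<e'$, ordered from innermost to outermost, $x_i=(x_{i_1},x_{i_2})$; $n_i$ is the number of dotted arcs $(y_1,y_2)$ with $x_{i_1}<y_1<a$ and $d<y_2<x_{i_2}$. Type I: $[ad,\overline{bc}]=[\overline{ab},cd]+[ab,\overline{cd}]+q^{-1}[\overline{ad},bc]+(1-q^{-2})\sum_{i=1}^\alpha q^{\,i-n_i}[ab,cd,\overline{x_i}]$. Type II: $[\overline{ab},\overline{cd}]=[\overline{ad},\overline{bc}]+(1-q^{-2})\sum_{i=1}^\alpha q^{\,i-1-n_i}[\overline{ad},bc,\overline{x_i}]$. (Here $[\ldots,\overline{x_i}]$ means that $x_i$ is dotted, the other $x_j$ staying undotted.) An arc $(p,p')$ is outer if no arc $(e,e')$ satisfies $e<p$ and $p'<e'$. $B_{n,k}\subset R^q_{n,k}$ is the set of (classes of) diagrams all of whose dots lie on outer arcs. *)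

theory Defs
  imports "HOL-Library.Poly_Mapping" "HOL-Algebra.AbelCoset" "Jordan_Normal_Form.VS_Connect"
begin

section \<open>Module-theoretic preliminaries\<close>

text \<open>
  The Laurent polynomials over the integers are the group ring of the integers: finitely supported
  functions from exponents to coefficients, with the convolution product of \<^theory>\<open>HOL-Library.Poly_Mapping\<close>.
\<close>

type_synonym laurent = "int \<Rightarrow>\<^sub>0 int"

definition qpow :: "int \<Rightarrow> laurent" where
  "qpow j = Poly_Mapping.single j 1"

definition laurent_ring :: "laurent ring" where
  "laurent_ring = class_ring"

definition cmul :: "'r \<Rightarrow> ('b \<Rightarrow>\<^sub>0 'r) \<Rightarrow> ('b \<Rightarrow>\<^sub>0 'r::comm_ring_1)" where
  "cmul a v = Poly_Mapping.map ((*) a) v"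

text \<open>
  The fields \<^term>\<open>mult\<close> and \<^term>\<open>one\<close> of a module record carry no meaning; they are filled with
  arbitrary values.
\<close>

definition free_module :: "'b set \<Rightarrow> ('r::comm_ring_1, 'b \<Rightarrow>\<^sub>0 'r) module" where
  "free_module S = \<lparr>carrier = {v. Poly_Mapping.keys v \<subseteq> S}, mult = (\<lambda>_ _. 0), one = 0,
     zero = 0, add = (+), smult = cmul\<rparr>"

definition quotient_module :: "('a, 'b, 'c) module_scheme \<Rightarrow> 'b set \<Rightarrow> ('a, 'b set) module" where
  "quotient_module M N = \<lparr>carrier = a_rcosets\<^bsub>M\<^esub> N, mult = (\<lambda>_ _. N), one = N,
     zero = N, add = set_add M, smult = (\<lambda>a X. \<Union>x\<in>X. N +>\<^bsub>M\<^esub> (a \<odot>\<^bsub>M\<^esub> x))\<rparr>"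

definition (in Module.module) module_basis :: "'c set \<Rightarrow> bool" where
  "module_basis B \<longleftrightarrow> lin_indpt B \<and> gen_set B \<and> B \<subseteq> carrier M"


section \<open>Dotted crossingless matchings\<close>

type_synonym arc = "nat \<times> nat"

text \<open>A diagram is a pair \<open>(M, D)\<close> of its set of arcs and its set of dotted arcs.\<close>

type_synonym diagram = "arc set \<times> arc set"

definition crossingless_matching :: "nat \<Rightarrow> arc set \<Rightarrow> bool" where
  "crossingless_matching n M \<longleftrightarrow>
     (\<forall>(p, p') \<in> M. 1 \<le> p \<and> p < p' \<and> p' \<le> 2 * n) \<and>
     (\<forall>v \<in> {1..2 * n}. \<exists>!e \<in> M. v = fst e \<or> v = snd e) \<and>
     \<not> (\<exists>(p, p') \<in> M. \<exists>(r, r') \<in> M. p < r \<and> r < p' \<and> p' < r')"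

definition diagrams :: "nat \<Rightarrow> nat \<Rightarrow> diagram set" where
  "diagrams n k = {(M, D). crossingless_matching n M \<and> D \<subseteq> M \<and> card D = k}"

definition outer_arc :: "arc set \<Rightarrow> arc \<Rightarrow> bool" where
  "outer_arc M x \<longleftrightarrow> x \<in> M \<and> \<not> (\<exists>(e, e') \<in> M. e < fst x \<and> snd x < e')"

definition outer_diagrams :: "nat \<Rightarrow> nat \<Rightarrow> diagram set" where
  "outer_diagrams n k = {(M, D) \<in> diagrams n k. \<forall>x \<in> D. outer_arc M x}"


section \<open>The quantum Russell relations\<close>

text \<open>
  In the relations, \<open>M\<close> is the set of arcs on which all the diagrams agree (so it does not contain the
  two arcs ending in \<open>a, b, c, d\<close>), and \<open>D \<subseteq> M\<close> is the set of those arcs of \<open>M\<close> that are dotted in all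
  the diagrams. The arcs \<open>ad\<close>, \<open>bc\<close>, \<open>ab\<close> and \<open>cd\<close> satisfy neither the strict inequalities defining the
  \<open>x\<^sub>i\<close> nor those in the definition of \<open>n\<^sub>i\<close>, so both can be computed from \<open>M\<close> and \<open>D\<close> alone.
\<close>

definition enclosing :: "arc set \<Rightarrow> arc set \<Rightarrow> nat \<Rightarrow> nat \<Rightarrow> arc set" where
  "enclosing M D a d = {x \<in> M - D. fst x < a \<and> d < snd x}"

text \<open>
  Since arcs enclosing a common interval are nested, the position \<open>i\<close> of \<open>x = x\<^sub>i\<close> in the list
  \<open>x\<^sub>1, \<dots>, x\<^sub>\<alpha>\<close>, ordered from innermost to outermost, is the number of members of the list that lie
  weakly inside \<open>x\<close>.
\<close>

definition position :: "arc set \<Rightarrow> arc set \<Rightarrow> nat \<Rightarrow> nat \<Rightarrow> arc \<Rightarrow> nat" where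
  "position M D a d x = card {y \<in> enclosing M D a d. fst x \<le> fst y \<and> snd y \<le> snd x}"

definition dots_between :: "arc set \<Rightarrow> nat \<Rightarrow> nat \<Rightarrow> arc \<Rightarrow> nat" where
  "dots_between D a d x =
     card {y \<in> D. fst x < fst y \<and> fst y < a \<and> d < snd y \<and> snd y < snd x}"

definition dg :: "arc set \<Rightarrow> arc set \<Rightarrow> diagram \<Rightarrow>\<^sub>0 laurent" where
  "dg M D = Poly_Mapping.single (M, D) 1"

definition type_I_lhs :: "arc set \<Rightarrow> arc set \<Rightarrow> nat \<Rightarrow> nat \<Rightarrow> nat \<Rightarrow> nat \<Rightarrow> diagram \<Rightarrow>\<^sub>0 laurent" where
  "type_I_lhs M D a b c d = dg (M \<union> {(a, d), (b, c)}) (D \<union> {(b, c)})"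

definition type_I_rhs :: "arc set \<Rightarrow> arc set \<Rightarrow> nat \<Rightarrow> nat \<Rightarrow> nat \<Rightarrow> nat \<Rightarrow> diagram \<Rightarrow>\<^sub>0 laurent" where
  "type_I_rhs M D a b c d =
     dg (M \<union> {(a, b), (c, d)}) (D \<union> {(a, b)})
     + dg (M \<union> {(a, b), (c, d)}) (D \<union> {(c, d)})
     + cmul (qpow (- 1)) (dg (M \<union> {(a, d), (b, c)}) (D \<union> {(a, d)}))
     + cmul (1 - qpow (- 2))
         (\<Sum>x \<in> enclosing M D a d.
            cmul (qpow (int (position M D a d x) - int (dots_between D a d x)))
              (dg (M \<union> {(a, b), (c, d)}) (D \<union> {x})))"

definition type_II_lhs :: "arc set \<Rightarrow> arc set \<Rightarrow> nat \<Rightarrow> nat \<Rightarrow> nat \<Rightarrow> nat \<Rightarrow> diagram \<Rightarrow>\<^sub>0 laurent" where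
  "type_II_lhs M D a b c d = dg (M \<union> {(a, b), (c, d)}) (D \<union> {(a, b), (c, d)})"

definition type_II_rhs :: "arc set \<Rightarrow> arc set \<Rightarrow> nat \<Rightarrow> nat \<Rightarrow> nat \<Rightarrow> nat \<Rightarrow> diagram \<Rightarrow>\<^sub>0 laurent" where
  "type_II_rhs M D a b c d =
     dg (M \<union> {(a, d), (b, c)}) (D \<union> {(a, d), (b, c)})
     + cmul (1 - qpow (- 2))
         (\<Sum>x \<in> enclosing M D a d.
            cmul (qpow (int (position M D a d x) - 1 - int (dots_between D a d x)))
              (dg (M \<union> {(a, d), (b, c)}) (D \<union> {(a, d), x})))"

text \<open>
  A relation is imposed whenever all its terms are diagrams with \<open>k\<close> dots. That neither arc on
  \<open>a, b, c, d\<close> lies in \<open>M\<close> follows from the two matching conditions.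
\<close>

definition admissible :: "nat \<Rightarrow> arc set \<Rightarrow> arc set \<Rightarrow> nat \<Rightarrow> nat \<Rightarrow> nat \<Rightarrow> nat \<Rightarrow> bool" where
  "admissible n M D a b c d \<longleftrightarrow> a < b \<and> b < c \<and> c < d \<and> D \<subseteq> M \<and>
     crossingless_matching n (M \<union> {(a, d), (b, c)}) \<and>
     crossingless_matching n (M \<union> {(a, b), (c, d)})"

definition russell_relators :: "nat \<Rightarrow> nat \<Rightarrow> (diagram \<Rightarrow>\<^sub>0 laurent) set" where
  "russell_relators n k =
     {type_I_lhs M D a b c d - type_I_rhs M D a b c d | M D a b c d.
        admissible n M D a b c d \<and> card D + 1 = k} \<union>
     {type_II_lhs M D a b c d - type_II_rhs M D a b c d | M D a b c d.
        admissible n M D a b c d \<and> card D + 2 = k}"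

definition free_diagram_module :: "nat \<Rightarrow> nat \<Rightarrow> (laurent, diagram \<Rightarrow>\<^sub>0 laurent) module" where
  "free_diagram_module n k = free_module (diagrams n k)"

definition russell_submodule :: "nat \<Rightarrow> nat \<Rightarrow> (diagram \<Rightarrow>\<^sub>0 laurent) set" where
  "russell_submodule n k =
     LinearCombinations.module.span laurent_ring (free_diagram_module n k) (russell_relators n k)"

definition quantum_russell_space ::
    "nat \<Rightarrow> nat \<Rightarrow> (laurent, (diagram \<Rightarrow>\<^sub>0 laurent) set) module" where
  "quantum_russell_space n k = quotient_module (free_diagram_module n k) (russell_submodule n k)"

definition diagram_class :: "nat \<Rightarrow> nat \<Rightarrow> diagram \<Rightarrow> (diagram \<Rightarrow>\<^sub>0 laurent) set" where
  "diagram_class n k \<delta> =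
     russell_submodule n k +>\<^bsub>free_diagram_module n k\<^esub> Poly_Mapping.single \<delta> 1"

definition outer_classes :: "nat \<Rightarrow> nat \<Rightarrow> (diagram \<Rightarrow>\<^sub>0 laurent) set set" where
  "outer_classes n k = diagram_class n k ` outer_diagrams n k"


section \<open>Well-definedness\<close>

lemma cring_laurent_ring: "cring laurent_ring"
  unfolding laurent_ring_def by (rule class_cring.cring_axioms)

lemma lookup_cmul [simp]: "Poly_Mapping.lookup (cmul a v) x = a * Poly_Mapping.lookup v x"
  by (simp add: cmul_def Poly_Mapping.map.rep_eq when_def)

lemma keys_cmul: "Poly_Mapping.keys (cmul a v) \<subseteq> Poly_Mapping.keys v"
  by (auto simp: in_keys_iff)

lemma module_free_module: "Module.module (class_ring :: 'r::comm_ring_1 ring) (free_module S)"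
proof (rule module_criteria)
  show "cring (class_ring :: 'r ring)"
    by (rule class_cring.cring_axioms)
  show "\<forall>v\<in>carrier (free_module S). \<exists>w\<in>carrier (free_module S).
          v \<oplus>\<^bsub>free_module S\<^esub> w = \<zero>\<^bsub>(free_module S :: ('r, _) module)\<^esub>"
  proof
    fix v :: "_ \<Rightarrow>\<^sub>0 'r"
    assume "v \<in> carrier (free_module S)"
    then show "\<exists>w\<in>carrier (free_module S). v \<oplus>\<^bsub>free_module S\<^esub> w = \<zero>\<^bsub>free_module S\<^esub>"
      by (intro bexI[of _ "- v"]) (simp_all add: free_module_def)
  qed
qed (auto simp: free_module_def lookup_add algebra_simps intro!: poly_mapping_eqI
      dest!: subsetD[OF keys_cmul] subsetD[OF Poly_Mapping.keys_add])

lemma (in Module.module) module_quotient_module: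
  assumes "submodule R N M"
  shows "Module.module R (quotient_module M N)"
proof -
  interpret N: submodule R N M by (rule assms)
  have sub: "N \<subseteq> carrier M" by (rule N.subset)
  have neg: "\<ominus>\<^bsub>M\<^esub> x \<in> N" if "x \<in> N" for x
  proof -
    have "(\<ominus>\<^bsub>R\<^esub> \<one>\<^bsub>R\<^esub>) \<odot>\<^bsub>M\<^esub> x \<in> N" using that by (intro N.smult_closed) auto
    moreover have "(\<ominus>\<^bsub>R\<^esub> \<one>\<^bsub>R\<^esub>) \<odot>\<^bsub>M\<^esub> x = \<ominus>\<^bsub>M\<^esub> x"
      using that sub by (simp add: smult_l_minus subsetD)
    ultimately show ?thesis by simp
  qed
  have ne: "N \<noteq> {}" using N.zero_closed by blast
  interpret A: abelian_subgroup N M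
  proof (rule abelian_subgroupI3)
    show "additive_subgroup N M"
      by (rule additive_subgroupI, rule group.subgroupI[OF M.a_group])
         (use sub neg ne N.m_closed in \<open>auto simp: a_inv_def\<close>)
  qed (rule M.abelian_group_axioms)
  have smult: "(\<Union>y\<in>N +>\<^bsub>M\<^esub> x. N +>\<^bsub>M\<^esub> (a \<odot>\<^bsub>M\<^esub> y)) = N +>\<^bsub>M\<^esub> (a \<odot>\<^bsub>M\<^esub> x)"
    if a: "a \<in> carrier R" and x: "x \<in> carrier M" for a x
  proof -
    have "N +>\<^bsub>M\<^esub> (a \<odot>\<^bsub>M\<^esub> y) = N +>\<^bsub>M\<^esub> (a \<odot>\<^bsub>M\<^esub> x)" if y: "y \<in> N +>\<^bsub>M\<^esub> x" for y
    proof -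
      obtain h where h: "h \<in> N" "y = h \<oplus>\<^bsub>M\<^esub> x"
        using y by (auto simp: a_r_coset_def')
      then have "a \<odot>\<^bsub>M\<^esub> y = (a \<odot>\<^bsub>M\<^esub> h) \<oplus>\<^bsub>M\<^esub> (a \<odot>\<^bsub>M\<^esub> x)"
        using a x sub by (simp add: smult_r_distr subsetD)
      then have "a \<odot>\<^bsub>M\<^esub> y \<in> N +>\<^bsub>M\<^esub> (a \<odot>\<^bsub>M\<^esub> x)"
        using a h(1) by (auto simp: a_r_coset_def')
      then show ?thesis
        using a x by (intro M.a_repr_independence[symmetric] A.a_subgroup) auto
    qed
    moreover have "x \<in> N +>\<^bsub>M\<^esub> x" using x by (rule A.a_rcos_self)
    ultimately show ?thesis by blast
  qed
  have carr: "X \<in> a_rcosets\<^bsub>M\<^esub> N \<longleftrightarrow> (\<exists>x\<in>carrier M. X = N +>\<^bsub>M\<^esub> x)" for X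
    by (auto simp: A_RCOSETS_def')
  have rcI: "N +>\<^bsub>M\<^esub> x \<in> a_rcosets\<^bsub>M\<^esub> N" if "x \<in> carrier M" for x
    using that carr by blast
  have rcE: thesis if "X \<in> a_rcosets\<^bsub>M\<^esub> N"
    "\<And>x. x \<in> carrier M \<Longrightarrow> X = N +>\<^bsub>M\<^esub> x \<Longrightarrow> thesis" for X thesis
    using that carr by blast
  have neg': "\<exists>Y\<in>a_rcosets\<^bsub>M\<^esub> N. X <+>\<^bsub>M\<^esub> Y = N" if X: "X \<in> a_rcosets\<^bsub>M\<^esub> N" for X
  proof -
    obtain x where x: "x \<in> carrier M" "X = N +>\<^bsub>M\<^esub> x" using X carr by auto
    then have "X <+>\<^bsub>M\<^esub> (N +>\<^bsub>M\<^esub> (\<ominus>\<^bsub>M\<^esub> x)) = N"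
      using sub by (simp add: A.a_rcos_sum M.r_neg)
    then show ?thesis using rcI[OF M.a_inv_closed[OF x(1)]] by (rule bexI)
  qed
  have N_in: "N \<in> a_rcosets\<^bsub>M\<^esub> N"
    using rcI[OF M.zero_closed] sub by simp
  have add_N: "X <+>\<^bsub>M\<^esub> N = X" if X: "X \<in> a_rcosets\<^bsub>M\<^esub> N" for X
  proof -
    obtain x where x: "x \<in> carrier M" "X = N +>\<^bsub>M\<^esub> x" using X carr by auto
    have "(N +>\<^bsub>M\<^esub> x) <+>\<^bsub>M\<^esub> (N +>\<^bsub>M\<^esub> \<zero>\<^bsub>M\<^esub>) = N +>\<^bsub>M\<^esub> x"
      using x by (subst A.a_rcos_sum) auto
    then show ?thesis using x sub by simp
  qed
  have Q: "carrier (quotient_module M N) = a_rcosets\<^bsub>M\<^esub> N"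
    "\<And>x y. x \<in> carrier M \<Longrightarrow> y \<in> carrier M \<Longrightarrow>
       (N +>\<^bsub>M\<^esub> x) \<oplus>\<^bsub>quotient_module M N\<^esub> (N +>\<^bsub>M\<^esub> y) = N +>\<^bsub>M\<^esub> (x \<oplus>\<^bsub>M\<^esub> y)"
    "\<And>a x. a \<in> carrier R \<Longrightarrow> x \<in> carrier M \<Longrightarrow>
       a \<odot>\<^bsub>quotient_module M N\<^esub> (N +>\<^bsub>M\<^esub> x) = N +>\<^bsub>M\<^esub> (a \<odot>\<^bsub>M\<^esub> x)"
    by (simp_all add: quotient_module_def A.a_rcos_sum smult)
  show ?thesis
  proof (rule module_criteria)
    show "cring R" by (rule R.is_cring)
    show "\<zero>\<^bsub>quotient_module M N\<^esub> \<in> carrier (quotient_module M N)"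
      using N_in by (simp add: quotient_module_def)
    show "\<forall>v\<in>carrier (quotient_module M N). \<exists>w\<in>carrier (quotient_module M N).
            v \<oplus>\<^bsub>quotient_module M N\<^esub> w = \<zero>\<^bsub>quotient_module M N\<^esub>"
      using neg' by (simp add: quotient_module_def)
    show "\<forall>v\<in>carrier (quotient_module M N).
            v \<oplus>\<^bsub>quotient_module M N\<^esub> \<zero>\<^bsub>quotient_module M N\<^esub> = v"
      using add_N by (simp add: quotient_module_def)
  qed (auto simp: Q smult_l_distr smult_r_distr smult_assoc1 M.a_ac rcI elim!: rcE)
qed

lemma module_free_diagram_module: "Module.module laurent_ring (free_diagram_module n k)"
  unfolding laurent_ring_def free_diagram_module_def by (rule module_free_module)

lemma finite_crossingless_matching: "crossingless_matching n M \<Longrightarrow> finite M"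
  by (rule finite_subset[of _ "{..2 * n} \<times> {..2 * n}"])
     (fastforce simp: crossingless_matching_def)+

lemma admissible_notin:
  assumes "admissible n M D a b c d"
  shows "(a, b) \<notin> M" "(c, d) \<notin> M" "(a, d) \<notin> M" "(b, c) \<notin> M"
proof -
  note A = assms[unfolded admissible_def]
  have ad: "crossingless_matching n (M \<union> {(a, d), (b, c)})"
    and ab: "crossingless_matching n (M \<union> {(a, b), (c, d)})"
    and lt: "a < b" "b < c" "c < d" using A by auto
  have bounds: "1 \<le> a" "d \<le> 2 * n" using ad by (auto simp: crossingless_matching_def)
  have ends: "\<exists>!e. e \<in> N \<and> (v = fst e \<or> v = snd e)"
    if "crossingless_matching n N" "v \<in> {1..2 * n}" for N v
    using that by (auto simp: crossingless_matching_def)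
  have uniq: "e = e'" if "crossingless_matching n N" "v \<in> {1..2 * n}" "e \<in> N" "e' \<in> N"
    "v = fst e \<or> v = snd e" "v = fst e' \<or> v = snd e'" for N v e e'
    using ends[OF that(1,2)] that(3-6) by blast
  show "(a, b) \<notin> M" using uniq[OF ad, of a "(a, b)" "(a, d)"] lt bounds by auto
  show "(c, d) \<notin> M" using uniq[OF ad, of d "(c, d)" "(a, d)"] lt bounds by auto
  show "(a, d) \<notin> M" using uniq[OF ab, of a "(a, d)" "(a, b)"] lt bounds by auto
  show "(b, c) \<notin> M" using uniq[OF ab, of b "(b, c)" "(a, b)"] lt bounds by auto
qed

lemma keys_dg [simp]: "Poly_Mapping.keys (dg M D) = {(M, D)}"
  by (simp add: dg_def)

lemma keys_sum_subset:
  assumes "\<And>x. x \<in> A \<Longrightarrow> Poly_Mapping.keys (f x) \<subseteq> S"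
  shows "Poly_Mapping.keys (sum f A) \<subseteq> S"
  using Poly_Mapping.keys_sum[of f A] assms by fastforce

lemma russell_relators_closed: "russell_relators n k \<subseteq> carrier (free_diagram_module n k)"
proof
  fix v assume v: "v \<in> russell_relators n k"
  have add: "Poly_Mapping.keys (u + w) \<subseteq> S" "Poly_Mapping.keys (u - w) \<subseteq> S"
    if "Poly_Mapping.keys u \<subseteq> S" "Poly_Mapping.keys w \<subseteq> S"
    for u w :: "diagram \<Rightarrow>\<^sub>0 laurent" and S
    using that Poly_Mapping.keys_add[of u w] Poly_Mapping.keys_diff[of u w] by blast+
  have cm: "Poly_Mapping.keys (cmul a w) \<subseteq> S" if "Poly_Mapping.keys w \<subseteq> S"
    for a and w :: "diagram \<Rightarrow>\<^sub>0 laurent" and S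
    using that keys_cmul[of a w] by blast
  have fin: "finite D" if "admissible n M D a b c d" for M D a b c d
    using that finite_crossingless_matching[of n "M \<union> {(a, d), (b, c)}"]
    by (auto simp: admissible_def intro: finite_subset)
  have notin: "(a, b) \<notin> D" "(c, d) \<notin> D" "(a, d) \<notin> D" "(b, c) \<notin> D"
    if "admissible n M D a b c d" for M D a b c d
    using admissible_notin[OF that] that by (auto simp: admissible_def)
  from v consider
      (I) M D a b c d where "v = type_I_lhs M D a b c d - type_I_rhs M D a b c d"
        "admissible n M D a b c d" "card D + 1 = k"
    | (II) M D a b c d where "v = type_II_lhs M D a b c d - type_II_rhs M D a b c d"
        "admissible n M D a b c d" "card D + 2 = k"
    unfolding russell_relators_def by blast
  then have "Poly_Mapping.keys v \<subseteq> diagrams n k"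
  proof cases
    case I
    then show ?thesis
      unfolding I(1) type_I_lhs_def type_I_rhs_def
      using notin[OF I(2)] fin[OF I(2)]
      by (intro add cm keys_sum_subset)
         (auto simp: diagrams_def admissible_def enclosing_def)
  next
    case II
    have "x \<noteq> (a, d)" if "x \<in> enclosing M D a d" for x
      using that by (auto simp: enclosing_def)
    then show ?thesis
      unfolding II(1) type_II_lhs_def type_II_rhs_def
      using notin[OF II(2)] fin[OF II(2)] II(2,3)
      by (intro add cm keys_sum_subset)
         (auto simp: diagrams_def admissible_def enclosing_def card_insert_if)
  qed
  then show "v \<in> carrier (free_diagram_module n k)"
    by (simp add: free_diagram_module_def free_module_def)
qed

lemma submodule_russell_submodule:
  "submodule laurent_ring (russell_submodule n k) (free_diagram_module n k)"
  unfolding russell_submodule_def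
  by (rule module.span_is_submodule[OF module_free_diagram_module russell_relators_closed])

theorem module_quantum_russell_space: "Module.module laurent_ring (quantum_russell_space n k)"
  unfolding quantum_russell_space_def
  by (rule module.module_quotient_module[OF module_free_diagram_module submodule_russell_submodule])

end

theory Submission
  imports Defs
begin

text \<open>
  Spanning: applied to a dotted arc and the arc immediately around it, each Russell relation expresses
  a diagram by diagrams in which the total depth of the dotted arcs is smaller.

  Independence: for every set \<open>t\<close> of points there is a linear functional on diagrams that kills all
  Russell relations. On a diagram it is a product of local weights, one for each arc, if the total charge
  is \<open>0\<close>, and it vanishes otherwise. On a diagram with outer dots it can only be nonzero if \<open>t\<close> contains
  exactly one end of every undotted arc and no end of a dotted arc. Hence the functionals belonging to
  the sets of left ends of undotted arcs are unitriangular on the outer diagrams, with respect to the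
  sum of the elements of \<open>t\<close>.

  The relations hold for the functionals because the local terms of a relation differ exactly by
  the weight of its last diagram with one dot missing, and pushing the missing dot through the enclosing
  arcs, from the innermost to the outermost, produces the sum over the \<open>x\<^sub>i\<close>. What is left at the end
  has total charge \<open>-1\<close> and therefore vanishes.
\<close>

section \<open>Local weights\<close>

lemma qpow_mult: "qpow i * qpow j = qpow (i + j)"
  by (simp add: qpow_def mult_single)

lemma qpow_mult_left: "qpow i * (qpow j * z) = qpow (i + j) * z"
  by (simp add: qpow_mult flip: mult.assoc)

lemma qpow_0: "qpow 0 = 1"
  by (simp add: qpow_def)

lemmas qpow_simps = qpow_mult qpow_mult_left qpow_0 algebra_simps

text \<open>
  The weights below come from the tangle in which every dotted arc \<open>(p, p')\<close> is a pair of vertical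
  strands, the one from \<open>p\<close> passing over and the one from \<open>p'\<close> passing under all undotted arcs,
  evaluated with the \<open>R\<close>-matrix of the vector representation of quantum \<open>sl\<^sub>2\<close> on highest weight vectors at the bottom.
  The set \<open>t\<close> names a basis vector of the tensor power, and \<open>m\<close> is the charge of the arcs inside \<open>x\<close>.
\<close>

definition charge :: "nat set \<Rightarrow> arc set \<Rightarrow> arc set \<Rightarrow> int" where
  "charge t D A = (\<Sum>y\<in>A. of_bool (fst y \<in> t) + of_bool (snd y \<in> t) - of_bool (y \<notin> D))"

definition weight :: "nat set \<Rightarrow> arc set \<Rightarrow> arc \<Rightarrow> int \<Rightarrow> laurent" where
  "weight t D x m =
     (if x \<in> D then (if fst x \<in> t then 0 else qpow (- m))
      else if fst x \<in> t then (if snd x \<in> t then 0 else qpow m)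
      else if snd x \<in> t then - qpow (- 1 - m)
      else qpow (m - 1) - qpow (- 1 - m))"

definition inner :: "arc set \<Rightarrow> arc \<Rightarrow> arc set" where
  "inner M x = {y \<in> M. fst x < fst y \<and> snd y < snd x}"

definition state_weight :: "nat set \<Rightarrow> arc set \<Rightarrow> arc set \<Rightarrow> laurent" where
  "state_weight t M D = (\<Prod>x\<in>M. weight t D x (charge t D (inner M x)))"

fun amplitude :: "nat set \<Rightarrow> diagram \<Rightarrow> laurent" where
  "amplitude t (M, D) = (if charge t D M = 0 then state_weight t M D else 0)"

text \<open>If the left end of \<open>x\<close> is in \<open>t\<close>, one more unit of charge
  inside multiplies the weight by q, and the dotted weight is 0. Otherwise the term
  \<open>- qpow (- 1 - m)\<close> is multiplied by the inverse of q instead, and (1 - q^-2) times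
  the dotted weight \<open>qpow (- m)\<close> makes up the difference.\<close>

lemma weight_undotted_step:
  assumes "x \<notin> D" "x \<in> D'"
  shows "weight t D x (m + 1) = (1 - qpow (- 2)) * weight t D' x m + qpow 1 * weight t D x m"
  using assms by (simp add: weight_def qpow_simps)

lemma weight_dotted_step:
  assumes "x \<in> D"
  shows "weight t D x (m + 1) = qpow (- 1) * weight t D x m"
  using assms by (simp add: weight_def qpow_simps)

text \<open>
  Telescoping over a chain of nested arcs: the two step equations above trade \<open>g\<close> (charge \<open>m + 1\<close>)
  for \<open>h\<close> (charge \<open>m\<close>), starting from the innermost arc, and \<open>w\<close> is the weight of the same arc with a
  dot. This is where the sums over the \<open>x\<^sub>i\<close> in the Russell relations come from.
\<close>

lemma chain_expansion:
  fixes g h w :: "arc \<Rightarrow> laurent"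
  assumes "finite E"
    and chain: "\<And>x y. x \<in> E \<Longrightarrow> y \<in> E \<Longrightarrow> x \<noteq> y \<Longrightarrow>
      fst x < fst y \<and> snd y < snd x \<or> fst y < fst x \<and> snd x < snd y"
    and und: "\<And>x. x \<in> E - D \<Longrightarrow> g x = (1 - qpow (- 2)) * w x + qpow 1 * h x"
    and dot: "\<And>x. x \<in> E \<inter> D \<Longrightarrow> g x = qpow (- 1) * h x"
  shows "prod g E = qpow (int (card (E - D)) - int (card (E \<inter> D))) * prod h E
    + (1 - qpow (- 2)) * (\<Sum>x\<in>E - D.
        qpow (int (card {y \<in> E - D. fst x \<le> fst y \<and> snd y \<le> snd x}) - 1
          - int (card {y \<in> E \<inter> D. fst x < fst y \<and> snd y < snd x}))
        * (prod h {y \<in> E. fst x < fst y \<and> snd y < snd x} * w x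
          * prod g {y \<in> E. fst y < fst x \<and> snd x < snd y}))"
  using assms
proof (induction "card E" arbitrary: E)
  case 0
  then show ?case by (simp add: qpow_0)
next
  case (Suc n)
  let ?T = "\<lambda>E x. qpow (int (card {y \<in> E - D. fst x \<le> fst y \<and> snd y \<le> snd x}) - 1
          - int (card {y \<in> E \<inter> D. fst x < fst y \<and> snd y < snd x}))
        * (prod h {y \<in> E. fst x < fst y \<and> snd y < snd x} * w x
          * prod g {y \<in> E. fst y < fst x \<and> snd x < snd y})"
  \<comment> \<open>The induction peels off the outermost arc \<open>z\<close>, recognised by the
    largest right end; every other arc of \<open>E\<close> lies inside it.\<close>
  have "E \<noteq> {}" using Suc by auto
  then have "Max (snd ` E) \<in> snd ` E" using Suc by (intro Max_in) auto
  then obtain z where z: "z \<in> E" "snd z = Max (snd ` E)" by auto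
  define F where "F = E - {z}"
  have E: "E = insert z F" "z \<notin> F" using z by (auto simp: F_def)
  have finF: "finite F" using Suc.prems(1) by (simp add: F_def)
  have zF: "fst z < fst x \<and> snd x < snd z" if "x \<in> F" for x
  proof -
    have "snd x \<le> snd z" unfolding z(2) using that Suc.prems(1) by (auto simp: F_def)
    then show ?thesis using Suc.prems(2)[OF z(1), of x] that by (auto simp: F_def)
  qed
  have IH: "prod g F = qpow (int (card (F - D)) - int (card (F \<inter> D))) * prod h F
    + (1 - qpow (- 2)) * (\<Sum>x\<in>F - D. ?T F x)"
    by (rule Suc.hyps(1)) (use Suc.hyps(2) Suc.prems E finF in auto)
  \<comment> \<open>As \<open>z\<close> lies outside \<open>x\<close>, it enters the summand of
    \<open>x\<close> only as a further factor \<open>g z\<close>; the exponent does not see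
    it.\<close>
  have TF: "?T E x = g z * ?T F x" if "x \<in> F" for x
  proof -
    note zx = zF[OF that]
    have "{y \<in> E - D. fst x \<le> fst y \<and> snd y \<le> snd x} = {y \<in> F - D. fst x \<le> fst y \<and> snd y \<le> snd x}"
      "{y \<in> E \<inter> D. fst x < fst y \<and> snd y < snd x} = {y \<in> F \<inter> D. fst x < fst y \<and> snd y < snd x}"
      "{y \<in> E. fst x < fst y \<and> snd y < snd x} = {y \<in> F. fst x < fst y \<and> snd y < snd x}"
      "{y \<in> E. fst y < fst x \<and> snd x < snd y} = insert z {y \<in> F. fst y < fst x \<and> snd x < snd y}"
      using zx E by auto
    then show ?thesis using E(2) finF by simp
  qed
  show ?case
  proof (cases "z \<in> D")
    case True
    then have "E - D = F - D" "E \<inter> D = insert z (F \<inter> D)" using E by auto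
    moreover have "z \<notin> F \<inter> D" using E by auto
    moreover have "(\<Sum>x\<in>F - D. ?T E x) = g z * (\<Sum>x\<in>F - D. ?T F x)"
      by (subst sum_distrib_left) (rule sum.cong[OF refl TF], auto)
    moreover have "g z = qpow (- 1) * h z" using Suc.prems(4) z True by auto
    ultimately have "prod g E = qpow (- 1) * h z
        * (qpow (int (card (E - D)) - (int (card (E \<inter> D)) - 1)) * prod h F)
        + (1 - qpow (- 2)) * (\<Sum>x\<in>E - D. ?T E x)"
      using E finF IH by (simp add: distrib_left mult.left_commute del: diff_diff_eq2)
    also have "qpow (- 1) * h z * (qpow (int (card (E - D)) - (int (card (E \<inter> D)) - 1)) * prod h F)
      = qpow (int (card (E - D)) - int (card (E \<inter> D))) * prod h E"
      using E finF by (simp add: qpow_simps)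
    finally show ?thesis .
  next
    case False
    have sets: "E - D = insert z (F - D)" "E \<inter> D = F \<inter> D" using E False by auto
    have zs: "{y \<in> E - D. fst z \<le> fst y \<and> snd y \<le> snd z} = insert z (F - D)"
      "{y \<in> E \<inter> D. fst z < fst y \<and> snd y < snd z} = F \<inter> D"
      "{y \<in> E. fst z < fst y \<and> snd y < snd z} = F"
      "{y \<in> E. fst y < fst z \<and> snd z < snd y} = {}"
      using zF E False by (auto simp: less_imp_le dest: zF less_asym)
    have Tz: "?T E z = qpow (int (card (F - D)) - int (card (F \<inter> D))) * prod h F * w z"
      unfolding zs using E finF by (simp add: mult.assoc)
    have "(\<Sum>x\<in>F - D. ?T E x) = g z * (\<Sum>x\<in>F - D. ?T F x)"
      by (subst sum_distrib_left) (rule sum.cong[OF refl TF], auto)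
    then have s: "(\<Sum>x\<in>E - D. ?T E x) = ?T E z + g z * (\<Sum>x\<in>F - D. ?T F x)"
      unfolding sets using E finF by (subst sum.insert) auto
    \<comment> \<open>The \<open>h\<close> part of \<open>g z\<close> extends the leading product
      from \<open>F\<close> to \<open>E\<close>; the \<open>w\<close> part is exactly the new
      summand for \<open>x = z\<close>, which has all of \<open>F\<close> inside it.\<close>
    have gz: "g z = (1 - qpow (- 2)) * w z + qpow 1 * h z" using Suc.prems(3) z False by auto
    have c: "card (E - D) = Suc (card (F - D))" unfolding sets using E finF by simp
    have "prod g E = g z * prod g F" using E finF by simp
    also have "\<dots> = g z * (qpow (int (card (F - D)) - int (card (F \<inter> D))) * prod h F)
      + (1 - qpow (- 2)) * (g z * (\<Sum>x\<in>F - D. ?T F x))"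
      unfolding IH by (simp add: algebra_simps)
    also have "g z * (qpow (int (card (F - D)) - int (card (F \<inter> D))) * prod h F)
      = qpow (int (card (E - D)) - int (card (E \<inter> D))) * prod h E + (1 - qpow (- 2)) * ?T E z"
      unfolding Tz unfolding gz c sets(2) using E finF by (simp add: qpow_simps)
    finally show ?thesis unfolding s by (simp add: algebra_simps)
  qed
qed

text \<open>Here \<open>m1\<close>, \<open>m2\<close>, \<open>m3\<close> stand for the charges in
  the gaps ab, bc, cd; the charge inside ad also includes that of bc, which is 1 smaller when bc is
  undotted. The last term has no dot at the site: it is the defect that the sum over the enclosing
  arcs has to supply. The identity is checked for each of the 16 states of the four ends.\<close>

lemma type_I_local:
  fixes m1 m2 m3 :: int and t :: "nat set"
  assumes "a < b" "b < c" "c < (d::nat)"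
  defines "w \<equiv> \<lambda>D x m. weight t D x m" and "\<beta> \<equiv> \<lambda>v. of_bool (v \<in> t) :: int"
  shows "w {(b, c)} (a, d) (m1 + m2 + m3 + (\<beta> b + \<beta> c)) * w {(b, c)} (b, c) m2
    = w {(a, b)} (a, b) m1 * w {(a, b)} (c, d) m3 + w {(c, d)} (a, b) m1 * w {(c, d)} (c, d) m3
      + qpow (- 1) * (w {(a, d)} (a, d) (m1 + m2 + m3 + (\<beta> b + \<beta> c - 1)) * w {(a, d)} (b, c) m2)
      + qpow 1 * (w {} (a, b) m1 * w {} (c, d) m3)"
  using assms(1-3) unfolding w_def \<beta>_def
  by (cases "a \<in> t"; cases "b \<in> t"; cases "c \<in> t"; cases "d \<in> t")
    (simp_all add: weight_def qpow_simps, (rule arg_cong[of _ _ qpow], simp)+)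

text \<open>The defect is now the nested diagram whose dot on bc is missing. The gap charge
  \<open>m2\<close> occurs only on the right, where its contributions cancel.\<close>

lemma type_II_local:
  fixes m1 m2 m3 :: int and t :: "nat set"
  assumes "a < b" "b < c" "c < (d::nat)"
  defines "w \<equiv> \<lambda>D x m. weight t D x m" and "\<beta> \<equiv> \<lambda>v. of_bool (v \<in> t) :: int"
  shows "w {(a, b), (c, d)} (a, b) m1 * w {(a, b), (c, d)} (c, d) m3
    = w {(a, d), (b, c)} (a, d) (m1 + m2 + m3 + (\<beta> b + \<beta> c)) * w {(a, d), (b, c)} (b, c) m2
      + w {(a, d)} (a, d) (m1 + m2 + m3 + (\<beta> b + \<beta> c - 1)) * w {(a, d)} (b, c) m2"
  using assms(1-3) unfolding w_def \<beta>_def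
  by (cases "a \<in> t"; cases "b \<in> t"; cases "c \<in> t"; cases "d \<in> t")
    (simp_all add: weight_def qpow_simps)

section \<open>Invariance of the amplitudes\<close>

lemma matching_arc:
  assumes "crossingless_matching n M" "x \<in> M"
  shows "1 \<le> fst x" "fst x < snd x" "snd x \<le> 2 * n"
  using assms by (auto simp: crossingless_matching_def)

lemma matching_uncrossed:
  assumes "crossingless_matching n M" "x \<in> M" "y \<in> M"
  shows "\<not> (fst x < fst y \<and> fst y < snd x \<and> snd x < snd y)"
proof -
  have "\<not> (\<exists>(p, p') \<in> M. \<exists>(r, r') \<in> M. p < r \<and> r < p' \<and> p' < r')"
    using assms(1) unfolding crossingless_matching_def by blast
  then show ?thesis using assms(2,3) by (cases x, cases y) auto
qed

lemma matching_unique: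
  assumes "crossingless_matching n M" "x \<in> M" "y \<in> M"
    "v = fst x \<or> v = snd x" "v = fst y \<or> v = snd y"
  shows "x = y"
proof -
  have "v \<in> {1..2 * n}" using matching_arc[OF assms(1,2)] assms(4) by auto
  then have "\<exists>!e. e \<in> M \<and> (v = fst e \<or> v = snd e)"
    using assms(1) by (auto simp: crossingless_matching_def)
  then show ?thesis using assms(2-) by blast
qed

lemma matching_cover:
  assumes "crossingless_matching n M" "1 \<le> v" "v \<le> 2 * n"
  obtains x where "x \<in> M" "v = fst x \<or> v = snd x"
proof -
  have "\<exists>!e. e \<in> M \<and> (v = fst e \<or> v = snd e)"
    using assms by (auto simp: crossingless_matching_def)
  then show ?thesis using that by blast
qed

lemma matching_disjoint:
  assumes "crossingless_matching n M" "x \<in> M" "y \<in> M" "x \<noteq> y"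
  shows "fst x \<noteq> fst y" "fst x \<noteq> snd y" "snd x \<noteq> fst y" "snd x \<noteq> snd y"
  using matching_unique[OF assms(1-3)] assms(4) by auto

lemma matching_nested:
  assumes "crossingless_matching n M" "x \<in> M" "y \<in> M" "x \<noteq> y"
    "fst x < v" "v < snd x" "fst y < v" "v < snd y"
  shows "fst x < fst y \<and> snd y < snd x \<or> fst y < fst x \<and> snd x < snd y"
  using matching_disjoint[OF assms(1-4)] matching_uncrossed[OF assms(1,2,3)]
    matching_uncrossed[OF assms(1,3,2)] assms(5-) by linarith

section \<open>Locality of weights, additivity and positivity of charges\<close>

lemma weight_cong: "(x \<in> D \<longleftrightarrow> x \<in> D') \<Longrightarrow> weight t D x = weight t D' x"
  by (rule ext) (simp add: weight_def)

lemma charge_cong: "A \<inter> D = A \<inter> D' \<Longrightarrow> charge t D A = charge t D' A"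
  unfolding charge_def by (rule sum.cong) auto

lemma charge_union:
  "finite A \<Longrightarrow> finite B \<Longrightarrow> A \<inter> B = {} \<Longrightarrow> charge t D (A \<union> B) = charge t D A + charge t D B"
  unfolding charge_def by (rule sum.union_disjoint)

lemma charge_dot:
  assumes "finite A" "x \<notin> D"
  shows "charge t (insert x D) A = charge t D A + of_bool (x \<in> A)"
proof (cases "x \<in> A")
  case True
  have "charge t (insert x D) (A - {x}) = charge t D (A - {x})"
    by (rule charge_cong) auto
  moreover have "charge t E A = charge t E {x} + charge t E (A - {x})" for E
    using charge_union[of "{x}" "A - {x}"] True assms(1) by (simp add: insert_absorb)
  moreover have "charge t (insert x D) {x} = charge t D {x} + 1"
    using assms(2) by (simp add: charge_def)
  ultimately show ?thesis using True by simp
next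
  case False
  then show ?thesis using charge_cong[of A "insert x D" D] by simp
qed

text \<open>
  An undotted arc with both ends outside \<open>t\<close> is the only one that lowers the charge, and its weight
  vanishes when the charge inside it is \<open>0\<close>.
\<close>

lemma charge_nonneg:
  assumes M: "crossingless_matching n M" and nz: "state_weight t M D \<noteq> 0"
    and "A \<subseteq> M" "\<And>y. y \<in> A \<Longrightarrow> inner M y \<subseteq> A"
  shows "0 \<le> charge t D A"
  using assms(3,4)
proof (induction "card A" arbitrary: A rule: less_induct)
  case less
  have finM: "finite M" using M by (rule finite_crossingless_matching)
  then have fin: "finite A" using less.prems(1) by (rule finite_subset[rotated])
  show ?case
  proof (cases "A = {}")
    case True
    then show ?thesis by (simp add: charge_def)
  next
    case False
    \<comment> \<open>The arc \<open>y\<close> that starts first in \<open>A\<close> lies inside no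
      other arc of \<open>A\<close>. So \<open>A\<close> splits into \<open>y\<close>, the set
      \<open>I\<close> of arcs inside \<open>y\<close> and the rest \<open>J\<close>, where
      \<open>I\<close> and \<open>J\<close> are again closed under passing to inner arcs.\<close>
    then have "Min (fst ` A) \<in> fst ` A" using fin by (intro Min_in) auto
    then obtain y where y: "y \<in> A" "fst y = Min (fst ` A)" by auto
    have yM: "y \<in> M" using y less.prems by auto
    have first: "fst y \<le> fst z" if "z \<in> A" for z unfolding y(2) using fin that by auto
    have nzy: "weight t D y (charge t D (inner M y)) \<noteq> 0"
      using nz finM yM unfolding state_weight_def by (metis prod_zero)
    define I where "I = inner M y"
    have IA: "I \<subseteq> A" "y \<notin> I" using less.prems(2)[OF y(1)] by (auto simp: I_def inner_def)
    have finI: "finite I" using IA fin finite_subset by blast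
    have chI: "0 \<le> charge t D I"
    proof (rule less.hyps)
      show "card I < card A" using IA y fin by (intro psubset_card_mono) auto
      show "I \<subseteq> M" using IA less.prems by auto
    qed (auto simp: I_def inner_def)
    define J where "J = A - insert y I"
    have chJ: "0 \<le> charge t D J"
    proof (rule less.hyps)
      show "card J < card A" using y fin unfolding J_def by (intro psubset_card_mono) auto
      show "J \<subseteq> M" using less.prems by (auto simp: J_def)
      fix z assume z: "z \<in> J"
      have zA: "z \<in> A" "z \<noteq> y" "z \<notin> I" using z by (auto simp: J_def)
      have zM: "z \<in> M" using zA less.prems by auto
      show "inner M z \<subseteq> J"
      proof
        fix u assume u: "u \<in> inner M z"
        have uM: "u \<in> M" "fst z < fst u" "snd u < snd z" using u by (auto simp: inner_def)
        have "u \<in> A" using less.prems(2)[OF zA(1)] u by auto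
        moreover have "u \<noteq> y" using uM first[OF zA(1)] by auto
        \<comment> \<open>An arc inside both \<open>y\<close> and \<open>z\<close> would force
          \<open>z\<close> inside \<open>y\<close>, because \<open>y\<close> starts first and the
          two do not cross.\<close>
        moreover have "u \<notin> I"
        proof
          assume uI: "u \<in> I"
          have "fst u < snd u" using matching_arc[OF M uM(1)] by simp
          with uI uM have "fst y < fst z \<and> snd z < snd y"
            using matching_disjoint[OF M zM yM zA(2)] first[OF zA(1)]
              matching_uncrossed[OF M yM zM] by (auto simp: I_def inner_def)
          then show False using zA zM by (auto simp: I_def inner_def)
        qed
        ultimately show "u \<in> J" by (auto simp: J_def)
      qed
    qed
    have "A = ({y} \<union> I) \<union> J" using IA y by (auto simp: J_def)
    then have "charge t D A = charge t D ({y} \<union> I) + charge t D J"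
      using finI fin by (subst charge_union[symmetric]) (auto simp: J_def)
    also have "charge t D ({y} \<union> I) = charge t D {y} + charge t D I"
      using finI IA by (intro charge_union) auto
    finally have eq: "charge t D A = charge t D {y} + charge t D I + charge t D J" .
    show ?thesis
    proof (cases "fst y \<notin> t \<and> snd y \<notin> t \<and> y \<notin> D")
      case True
      \<comment> \<open>The charge inside \<open>y\<close> is nonzero, hence at least 1, and pays
        for the -1 that \<open>y\<close> contributes.\<close>
      then have "charge t D I \<noteq> 0" using nzy by (auto simp: weight_def I_def)
      moreover have "charge t D {y} = -1" using True by (simp add: charge_def)
      ultimately show ?thesis using eq chI chJ by linarith
    next
      case False
      then have "0 \<le> charge t D {y}" by (auto simp: charge_def)
      then show ?thesis using eq chI chJ by linarith
    qed
  qed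
qed

text \<open>This disposes of the remainder of the telescoping, which is the weight of a diagram with
  one dot missing and total charge -1.\<close>

lemma state_weight_negative_charge:
  assumes "crossingless_matching n M" "charge t D M < 0"
  shows "state_weight t M D = 0"
  using charge_nonneg[OF assms(1), of t D M] assms(2) by (auto simp: inner_def)

section \<open>The four points of a relation and the arcs around them\<close>

locale relation_site =
  fixes n :: nat and M :: "arc set" and a b c d :: nat
  assumes less: "a < b" "b < c" "c < d"
    and nested: "crossingless_matching n (M \<union> {(a, d), (b, c)})"
    and parallel: "crossingless_matching n (M \<union> {(a, b), (c, d)})"
begin

definition site :: "arc set \<Rightarrow> bool" where
  "site X \<longleftrightarrow> X = {(a, d), (b, c)} \<or> X = {(a, b), (c, d)}"

text \<open>Unlike in \<open>enclosing\<close>, dotted arcs are included: they too feel a change of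
  the charge inside them, and each one passed yields the factor q^-1 that
  \<open>dots_between\<close> counts.\<close>

definition encl :: "arc set" where
  "encl = {x \<in> M. fst x < a \<and> d < snd x}"

text \<open>The arcs of \<open>M\<close> feel the site only through its total charge
  \<open>s\<close>, and only if they enclose it. The dots \<open>D\<close> stay a parameter because
  the sums over the enclosing arcs add a dot to \<open>M\<close>.\<close>

definition context_weight :: "nat set \<Rightarrow> arc set \<Rightarrow> int \<Rightarrow> laurent" where
  "context_weight t D s = (\<Prod>x\<in>encl. weight t D x (charge t D (inner M x) + s))
    * (\<Prod>x\<in>M - encl. weight t D x (charge t D (inner M x)))"

lemma finite_M [simp]: "finite M"
  using finite_crossingless_matching[OF nested] by simp

lemma notin_M: "(a, b) \<notin> M" "(c, d) \<notin> M" "(a, d) \<notin> M" "(b, c) \<notin> M"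
  using admissible_notin[of n M "{}" a b c d] less nested parallel by (auto simp: admissible_def)

lemma site_facts:
  assumes "site X"
  shows "finite X" "X \<inter> M = {}" "crossingless_matching n (M \<union> X)"
  using assms notin_M nested parallel by (auto simp: site_def)

lemma ends_M:
  assumes "x \<in> M" "v \<in> {a, b, c, d}"
  shows "fst x \<noteq> v" "snd x \<noteq> v"
proof -
  have "x \<noteq> (a, d)" "x \<noteq> (b, c)" using assms notin_M by auto
  then show "fst x \<noteq> v" "snd x \<noteq> v"
    using matching_disjoint[OF nested, of x "(a, d)"] matching_disjoint[OF nested, of x "(b, c)"] assms
    by auto
qed

lemma uncrossed_M:
  assumes "x \<in> M" "e \<in> {(a, b), (c, d), (a, d), (b, c)}"
  shows "\<not> (fst x < fst e \<and> fst e < snd x \<and> snd x < snd e)"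
    "\<not> (fst e < fst x \<and> fst x < snd e \<and> snd e < snd x)"
proof -
  have "e \<in> M \<union> {(a, d), (b, c)} \<or> e \<in> M \<union> {(a, b), (c, d)}" using assms by auto
  then show "\<not> (fst x < fst e \<and> fst e < snd x \<and> snd x < snd e)"
    "\<not> (fst e < fst x \<and> fst x < snd e \<and> snd e < snd x)"
    using matching_uncrossed[OF nested, of x e] matching_uncrossed[OF parallel, of x e]
      matching_uncrossed[OF nested, of e x] matching_uncrossed[OF parallel, of e x] assms(1)
    by blast+
qed

lemma arc_M: "x \<in> M \<Longrightarrow> fst x < snd x"
  using matching_arc(2)[OF nested, of x] by auto

text \<open>An arc of \<open>M\<close> crosses none of ab, cd, ad, bc, since each of these occurs
  together with it in one of the two matchings. Hence it cannot enclose one of them without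
  enclosing the whole interval from \<open>a\<close> to \<open>d\<close>.\<close>

lemma encloses_site:
  assumes "x \<in> M" "site X" "e \<in> X"
  shows "fst x < fst e \<and> snd e < snd x \<longleftrightarrow> x \<in> encl"
proof -
  have ends: "fst x \<noteq> a" "snd x \<noteq> d" using ends_M[OF assms(1)] by auto
  have un: "\<not> (a < fst x \<and> fst x < b \<and> b < snd x)"
    "\<not> (fst x < a \<and> a < snd x \<and> snd x < d)" "\<not> (a < fst x \<and> fst x < d \<and> d < snd x)"
    using uncrossed_M[OF assms(1), of "(a, b)"] uncrossed_M[OF assms(1), of "(a, d)"] by auto
  consider "e = (a, d)" | "e = (b, c)" | "e = (a, b)" | "e = (c, d)"
    using assms by (auto simp: site_def)
  then show ?thesis
    using ends un less assms(1) unfolding encl_def by cases (simp; linarith)+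
qed

lemma inner_site:
  assumes "x \<in> M" "site X"
  shows "inner (M \<union> X) x = inner M x \<union> (if x \<in> encl then X else {})"
  using encloses_site[OF assms] by (auto simp: inner_def)

text \<open>An arc of \<open>M\<close> below ad cannot straddle \<open>b\<close> without crossing
  ab, nor start between \<open>b\<close> and \<open>c\<close> and end beyond \<open>c\<close>
  without crossing bc. So it lies in one of the three gaps.\<close>

lemma inner_gaps:
  "inner (M \<union> {(a, d), (b, c)}) (a, d)
     = inner M (a, b) \<union> inner M (b, c) \<union> inner M (c, d) \<union> {(b, c)}"
  "inner (M \<union> {(a, d), (b, c)}) (b, c) = inner M (b, c)"
  "inner (M \<union> {(a, b), (c, d)}) (a, b) = inner M (a, b)"
  "inner (M \<union> {(a, b), (c, d)}) (c, d) = inner M (c, d)"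
proof -
  have "inner M (a, d) = inner M (a, b) \<union> inner M (b, c) \<union> inner M (c, d)"
  proof -
    have "y \<in> inner M (a, b) \<union> inner M (b, c) \<union> inner M (c, d)" if "y \<in> inner M (a, d)" for y
    proof -
      have y: "y \<in> M" "a < fst y" "snd y < d" using that by (auto simp: inner_def)
      have ends: "fst y \<notin> {a, b, c, d}" "snd y \<notin> {a, b, c, d}" using ends_M[OF y(1)] by blast+
      have un: "\<not> (a < fst y \<and> fst y < b \<and> b < snd y)" "\<not> (b < fst y \<and> fst y < c \<and> c < snd y)"
        using uncrossed_M[OF y(1), of "(a, b)"] uncrossed_M[OF y(1), of "(b, c)"] by auto
      show ?thesis using y ends un arc_M[OF y(1)] by (auto simp: inner_def)
    qed
    then show ?thesis using less by (auto simp: inner_def)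
  qed
  moreover have "inner (M \<union> {(a, d), (b, c)}) (a, d) = inner M (a, d) \<union> {(b, c)}"
    using less by (auto simp: inner_def)
  ultimately show "inner (M \<union> {(a, d), (b, c)}) (a, d)
     = inner M (a, b) \<union> inner M (b, c) \<union> inner M (c, d) \<union> {(b, c)}"
    by simp
qed (use less in \<open>auto simp: inner_def\<close>)

lemma gaps_disjoint:
  "inner M (a, b) \<inter> inner M (b, c) = {}" "inner M (a, b) \<inter> inner M (c, d) = {}"
  "inner M (b, c) \<inter> inner M (c, d) = {}"
  using less by (auto simp: inner_def dest!: arc_M)

lemma finite_inner [simp]: "finite (inner M x)"
  by (simp add: inner_def)

text \<open>The product factors into site and context: \<open>X\<close> is disjoint from
  \<open>M\<close>, so neither family of arcs sees the dots of the other on itself, and exactly the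
  arcs of \<open>encl\<close> have the charge of \<open>X\<close> added inside.\<close>

lemma state_weight_site:
  assumes "site X" "Y \<subseteq> X" "D \<subseteq> M"
  shows "state_weight t (M \<union> X) (D \<union> Y) =
    (\<Prod>e\<in>X. weight t Y e (charge t (D \<union> Y) (inner (M \<union> X) e)))
    * context_weight t D (charge t Y X)"
proof -
  note X = site_facts[OF assms(1)]
  let ?w = "\<lambda>x. weight t (D \<union> Y) x (charge t (D \<union> Y) (inner (M \<union> X) x))"
  have 1: "?w e = weight t Y e (charge t (D \<union> Y) (inner (M \<union> X) e))" if "e \<in> X" for e
  proof -
    have "e \<notin> D" using that X(2) assms(3) by blast
    then show ?thesis using weight_cong[of e "D \<union> Y" Y t] by simp
  qed
  have chM: "charge t (D \<union> Y) (inner M x) = charge t D (inner M x)" for x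
    using assms X by (intro charge_cong) (auto simp: inner_def)
  have w: "weight t (D \<union> Y) x = weight t D x" if "x \<in> M" for x
    using that assms X by (intro weight_cong) auto
  have 2: "?w x = weight t D x (charge t D (inner M x) + charge t Y X)" if "x \<in> encl" for x
  proof -
    have xM: "x \<in> M" using that by (simp add: encl_def)
    have "charge t (D \<union> Y) (inner M x \<union> X) = charge t (D \<union> Y) (inner M x) + charge t (D \<union> Y) X"
      using X by (intro charge_union) (auto simp: inner_def)
    also have "charge t (D \<union> Y) X = charge t Y X" using X assms by (intro charge_cong) auto
    finally show ?thesis using that xM by (simp add: inner_site[OF xM assms(1)] w chM)
  qed
  have 3: "?w x = weight t D x (charge t D (inner M x))" if "x \<in> M - encl" for x
    using that by (simp add: inner_site[OF _ assms(1)] w chM)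
  have fin: "finite encl" by (simp add: encl_def)
  have "M \<union> X = X \<union> (encl \<union> (M - encl))" by (auto simp: encl_def)
  then have "state_weight t (M \<union> X) (D \<union> Y) = prod ?w (X \<union> (encl \<union> (M - encl)))"
    unfolding state_weight_def by simp
  also have "\<dots> = prod ?w X * (prod ?w encl * prod ?w (M - encl))"
    using X fin by (subst prod.union_disjoint)
      (auto simp: encl_def simp del: Un_Diff_cancel intro!: arg_cong2[of _ _ _ _ times] prod.union_disjoint)
  also have "prod ?w X = (\<Prod>e\<in>X. weight t Y e (charge t (D \<union> Y) (inner (M \<union> X) e)))"
    by (rule prod.cong[OF refl 1])
  also have "prod ?w encl = (\<Prod>x\<in>encl. weight t D x (charge t D (inner M x) + charge t Y X))"
    by (rule prod.cong[OF refl 2])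
  also have "prod ?w (M - encl) = (\<Prod>x\<in>M - encl. weight t D x (charge t D (inner M x)))"
    by (rule prod.cong[OF refl 3])
  finally show ?thesis by (simp only: context_weight_def mult.assoc)
qed

lemma charge_site:
  assumes "site X" "Y \<subseteq> X" "D \<subseteq> M"
  shows "charge t (D \<union> Y) (M \<union> X) = charge t D M + charge t Y X"
proof -
  note X = site_facts[OF assms(1)]
  have "charge t (D \<union> Y) (M \<union> X) = charge t (D \<union> Y) M + charge t (D \<union> Y) X"
    using X by (intro charge_union) auto
  also have "charge t (D \<union> Y) M = charge t D M" using X assms by (intro charge_cong) auto
  also have "charge t (D \<union> Y) X = charge t Y X" using X assms by (intro charge_cong) auto
  finally show ?thesis .
qed

lemma encl_chain:
  assumes "x \<in> encl" "y \<in> encl" "x \<noteq> y"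
  shows "fst x < fst y \<and> snd y < snd x \<or> fst y < fst x \<and> snd x < snd y"
  using assms matching_nested[OF nested, of x y b] less by (auto simp: encl_def)

text \<open>The whole sum over the enclosing arcs equals the weight of the diagram without the extra
  dot, computed as if the charge of the site were 1 higher. Indeed, with a dot on \<open>x\<close>,
  the enclosing arcs outside \<open>x\<close> feel the extra unit of charge and those inside
  \<open>x\<close> do not, so the summands are those of \<open>chain_expansion\<close>.\<close>

lemma hook_expansion:
  assumes X: "site X" and Y: "Y \<subseteq> X" and D: "D \<subseteq> M"
  shows "(1 - qpow (- 2)) * (\<Sum>x\<in>enclosing M D a d.
      qpow (int (position M D a d x) - 1 - int (dots_between D a d x))
      * amplitude t (M \<union> X, insert x (D \<union> Y)))
    = (if charge t D M + (charge t Y X + 1) = 0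
       then (\<Prod>e\<in>X. weight t Y e (charge t (D \<union> Y) (inner (M \<union> X) e)))
         * context_weight t D (charge t Y X + 1)
       else 0)"
proof -
  define L where "L = (\<Prod>e\<in>X. weight t Y e (charge t (D \<union> Y) (inner (M \<union> X) e)))"
  define R where "R = (\<Prod>x\<in>M - encl. weight t D x (charge t D (inner M x)))"
  \<comment> \<open>For an enclosing arc, \<open>g\<close> is the weight when the extra dot lies
    inside it, \<open>h\<close> the weight when it does not, and \<open>w\<close> the weight when
    the arc itself carries that dot.\<close>
  define g where "g = (\<lambda>x. weight t D x (charge t D (inner M x) + (charge t Y X + 1)))"
  define h where "h = (\<lambda>x. weight t D x (charge t D (inner M x) + charge t Y X))"
  define w where "w = (\<lambda>x. weight t (insert x D) x (charge t D (inner M x) + charge t Y X))"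
  note Xf = site_facts[OF X]
  have encl_M: "encl \<subseteq> M" by (auto simp: encl_def)
  have fin_encl: "finite encl" using encl_M finite_M by (rule finite_subset)
  have enc: "encl - D = enclosing M D a d" by (auto simp: encl_def enclosing_def)
  have amp: "amplitude t (M \<union> X, insert x (D \<union> Y)) =
    (if charge t D M + (charge t Y X + 1) = 0
     then L * R * (prod h {y \<in> encl. fst x < fst y \<and> snd y < snd x} * w x
          * prod g {y \<in> encl. fst y < fst x \<and> snd x < snd y}) else 0)"
    if x: "x \<in> encl - D" for x
  proof -
    have D': "insert x D \<subseteq> M" "insert x (D \<union> Y) = insert x D \<union> Y" using x D encl_M by auto
    \<comment> \<open>The dot on \<open>x\<close> is one unit of charge, felt exactly by the arcs
      strictly around \<open>x\<close>.\<close>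
    have ch: "charge t (insert x D) (inner M y)
        = charge t D (inner M y) + of_bool (fst y < fst x \<and> snd x < snd y)" for y
      using x encl_M by (subst charge_dot) (auto simp: inner_def)
    have tot: "charge t (insert x D \<union> Y) (M \<union> X) = charge t D M + (charge t Y X + 1)"
      using charge_site[OF X Y D'(1)] x encl_M by (subst charge_site[OF X Y D'(1)], subst charge_dot) auto
    have LX: "(\<Prod>e\<in>X. weight t Y e (charge t (insert x D \<union> Y) (inner (M \<union> X) e))) = L"
      unfolding L_def
    proof (rule prod.cong[OF refl])
      fix e assume e: "e \<in> X"
      have "x \<in> M" "x \<in> encl" using x encl_M by auto
      then have "x \<notin> inner (M \<union> X) e"
        using encloses_site[OF \<open>x \<in> M\<close> X e] by (auto simp: inner_def)
      then show "weight t Y e (charge t (insert x D \<union> Y) (inner (M \<union> X) e)) =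
        weight t Y e (charge t (D \<union> Y) (inner (M \<union> X) e))"
        using charge_cong[of "inner (M \<union> X) e" "insert x D \<union> Y" "D \<union> Y" t] by simp
    qed
    have RX: "(\<Prod>y\<in>M - encl. weight t (insert x D) y (charge t (insert x D) (inner M y))) = R"
      unfolding R_def
    proof (rule prod.cong[OF refl])
      fix y assume y: "y \<in> M - encl"
      then have "\<not> (fst y < fst x \<and> snd x < snd y)" "y \<noteq> x" using x by (auto simp: encl_def)
      then show "weight t (insert x D) y (charge t (insert x D) (inner M y))
        = weight t D y (charge t D (inner M y))"
        using weight_cong[of y "insert x D" D t] by (auto simp: ch)
    qed
    let ?f = "\<lambda>y. weight t (insert x D) y (charge t (insert x D) (inner M y) + charge t Y X)"
    let ?in = "{y \<in> encl. fst x < fst y \<and> snd y < snd x}"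
      and ?out = "{y \<in> encl. fst y < fst x \<and> snd x < snd y}"
    \<comment> \<open>The enclosing arcs form a chain, so all of them other than \<open>x\<close>
      lie either inside or outside \<open>x\<close>.\<close>
    have "encl = insert x (?in \<union> ?out)"
      using encl_chain x by blast
    then have "prod ?f encl = ?f x * prod ?f (?in \<union> ?out)"
      using fin_encl by (subst (1) \<open>encl = _\<close>, subst prod.insert) auto
    also have "prod ?f (?in \<union> ?out) = prod ?f ?in * prod ?f ?out"
      using fin_encl by (intro prod.union_disjoint) auto
    also have "prod ?f ?in = prod h ?in"
    proof (rule prod.cong[OF refl])
      fix y assume "y \<in> ?in"
      then have "y \<noteq> x" "\<not> (fst y < fst x \<and> snd x < snd y)" by auto
      then show "?f y = h y" using weight_cong[of y "insert x D" D t] by (auto simp: ch h_def)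
    qed
    also have "prod ?f ?out = prod g ?out"
    proof (rule prod.cong[OF refl])
      fix y assume "y \<in> ?out"
      then have "y \<noteq> x" "fst y < fst x \<and> snd x < snd y" by auto
      then show "?f y = g y"
        using weight_cong[of y "insert x D" D t] by (auto simp: ch g_def algebra_simps)
    qed
    also have "?f x = w x" by (simp add: ch w_def)
    finally have "prod ?f encl = prod h ?in * w x * prod g ?out" by (simp add: ac_simps)
    then have "state_weight t (M \<union> X) (insert x D \<union> Y) = L * R * (prod h ?in * w x * prod g ?out)"
      unfolding state_weight_site[OF X Y D'(1)] context_weight_def LX RX by (simp add: ac_simps)
    then show ?thesis by (simp only: D'(2) amplitude.simps tot)
  qed
  let ?p = "\<lambda>x. qpow (int (position M D a d x) - 1 - int (dots_between D a d x))"
  show ?thesis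
  proof (cases "charge t D M + (charge t Y X + 1) = 0")
    case False
    then show ?thesis using amp by (simp flip: enc)
  next
    case True
    \<comment> \<open>Without the extra dot the total charge is -1. This kills the term with
      \<open>prod h encl\<close> that the telescoping leaves over.\<close>
    have "state_weight t (M \<union> X) (D \<union> Y) = 0"
      using True by (intro state_weight_negative_charge[OF Xf(3)]) (simp add: charge_site[OF X Y D])
    then have res: "L * R * prod h encl = 0"
      unfolding state_weight_site[OF X Y D] context_weight_def L_def[symmetric] R_def[symmetric]
      by (simp add: ac_simps h_def)
    \<comment> \<open>\<open>position\<close> counts \<open>x\<close> itself; the \<open>- 1\<close>
      in the exponent leaves the number of undotted arcs strictly inside \<open>x\<close>.\<close>
    have pos: "card {y \<in> encl - D. fst x \<le> fst y \<and> snd y \<le> snd x} = position M D a d x" for x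
      unfolding enc position_def by simp
    have dots: "card {y \<in> encl \<inter> D. fst x < fst y \<and> snd y < snd x} = dots_between D a d x" for x
      unfolding dots_between_def using D by (intro arg_cong[of _ _ card]) (auto simp: encl_def)
    have alg: "l * (p * u + v * z) = p * (l * u) + v * (l * z)" for l p u v z :: laurent
      by (simp add: algebra_simps)
    have "prod g encl = qpow (int (card (encl - D)) - int (card (encl \<inter> D))) * prod h encl
      + (1 - qpow (- 2)) * (\<Sum>x\<in>encl - D. ?p x
        * (prod h {y \<in> encl. fst x < fst y \<and> snd y < snd x} * w x
          * prod g {y \<in> encl. fst y < fst x \<and> snd x < snd y}))"
      unfolding pos[symmetric] dots[symmetric]
    proof (rule chain_expansion[OF fin_encl encl_chain])
      show "g x = (1 - qpow (- 2)) * w x + qpow 1 * h x" if "x \<in> encl - D" for x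
        using that weight_undotted_step[of x D "insert x D"] by (simp add: g_def h_def w_def flip: add.assoc)
      show "g x = qpow (- 1) * h x" if "x \<in> encl \<inter> D" for x
        using that weight_dotted_step[of x D] by (simp add: g_def h_def flip: add.assoc)
    qed auto
    then have "L * R * prod g encl = qpow (int (card (encl - D)) - int (card (encl \<inter> D))) * (L * R * prod h encl)
      + (1 - qpow (- 2)) * (L * R * (\<Sum>x\<in>encl - D. ?p x
        * (prod h {y \<in> encl. fst x < fst y \<and> snd y < snd x} * w x
          * prod g {y \<in> encl. fst y < fst x \<and> snd x < snd y})))"
      by (simp only: alg)
    also have "\<dots> = (1 - qpow (- 2)) * (\<Sum>x\<in>encl - D. ?p x * (L * R
        * (prod h {y \<in> encl. fst x < fst y \<and> snd y < snd x} * w x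
          * prod g {y \<in> encl. fst y < fst x \<and> snd x < snd y})))"
      unfolding res sum_distrib_left by (simp add: ac_simps)
    also have "\<dots> = (1 - qpow (- 2)) * (\<Sum>x\<in>encl - D. ?p x * amplitude t (M \<union> X, insert x (D \<union> Y)))"
      using amp True by (intro arg_cong2[of _ _ _ _ times] sum.cong refl) (simp only: simp_thms if_True)
    finally show ?thesis
      unfolding enc[symmetric] context_weight_def L_def[symmetric] R_def[symmetric]
      using True by (simp add: ac_simps g_def)
  qed
qed

section \<open>The terms of the two relations\<close>

lemma charge_gap:
  assumes "D \<subseteq> M" "site X" "Y \<subseteq> X"
  shows "charge t (D \<union> Y) (inner M x) = charge t D (inner M x)"
  using assms site_facts(2)[OF assms(2)] by (intro charge_cong) (auto simp: inner_def)

lemma charge_nested: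
  assumes "D \<subseteq> M" "Y \<subseteq> {(a, d), (b, c)}"
  shows "charge t (D \<union> Y) (inner (M \<union> {(a, d), (b, c)}) (a, d)) =
    charge t D (inner M (a, b)) + charge t D (inner M (b, c)) + charge t D (inner M (c, d))
    + charge t Y {(b, c)}"
proof -
  have s: "site {(a, d), (b, c)}" by (simp add: site_def)
  have bc: "(b, c) \<notin> inner M x" for x using notin_M by (auto simp: inner_def)
  have "charge t (D \<union> Y) {(b, c)} = charge t Y {(b, c)}"
    using assms notin_M by (intro charge_cong) auto
  then show ?thesis
    unfolding inner_gaps using gaps_disjoint bc
    by (simp add: charge_union Int_Un_distrib2 charge_gap[OF assms(1) s assms(2)] del: Un_insert_right)
qed

text \<open>The charges \<open>s\<close> and \<open>s'\<close> are variables so that all terms of a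
  relation can be brought to literally the same charge condition and the same factor
  \<open>context_weight t D s\<close>.\<close>

lemma amplitude_nested:
  assumes D: "D \<subseteq> M" and Y: "Y \<subseteq> {(a, d), (b, c)}"
    and "charge t Y {(a, d), (b, c)} = s" "charge t Y {(b, c)} = s'"
  shows "amplitude t (M \<union> {(a, d), (b, c)}, D \<union> Y) =
    (if charge t D M + s = 0
     then weight t Y (a, d) (charge t D (inner M (a, b)) + charge t D (inner M (b, c))
         + charge t D (inner M (c, d)) + s') * weight t Y (b, c) (charge t D (inner M (b, c)))
       * context_weight t D s
     else 0)"
proof -
  have X: "site {(a, d), (b, c)}" by (simp add: site_def)
  have "(a, d) \<noteq> (b, c)" using less by auto
  then show ?thesis
    using state_weight_site[OF X Y D, of t] charge_site[OF X Y D, of t]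
    by (simp add: assms(3,4) charge_nested[OF D Y] inner_gaps(2) charge_gap[OF D X Y]
      del: Un_insert_right)
qed

lemma amplitude_parallel:
  assumes D: "D \<subseteq> M" and Y: "Y \<subseteq> {(a, b), (c, d)}"
    and "charge t Y {(a, b), (c, d)} = s"
  shows "amplitude t (M \<union> {(a, b), (c, d)}, D \<union> Y) =
    (if charge t D M + s = 0
     then weight t Y (a, b) (charge t D (inner M (a, b)))
       * weight t Y (c, d) (charge t D (inner M (c, d))) * context_weight t D s
     else 0)"
proof -
  have X: "site {(a, b), (c, d)}" by (simp add: site_def)
  have "(a, b) \<noteq> (c, d)" using less by auto
  then show ?thesis
    using state_weight_site[OF X Y D, of t] charge_site[OF X Y D, of t]
    by (simp add: assms(3) inner_gaps(3,4) charge_gap[OF D X Y] del: Un_insert_right)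
qed

text \<open>The right-hand side has the shape of \<open>amplitude_nested\<close>, with 1 added to
  the charge of the site in \<open>s\<close> only. Thus a whole sum over enclosing arcs enters the
  local identity as a single term.\<close>

lemma hook_nested:
  assumes D: "D \<subseteq> M" and Y: "Y \<subseteq> {(a, d), (b, c)}"
    and "charge t Y {(a, d), (b, c)} + 1 = s" "charge t Y {(b, c)} = s'"
  shows "(1 - qpow (- 2)) * (\<Sum>x\<in>enclosing M D a d.
      qpow (int (position M D a d x) - 1 - int (dots_between D a d x))
      * amplitude t (M \<union> {(a, d), (b, c)}, insert x (D \<union> Y))) =
    (if charge t D M + s = 0
     then weight t Y (a, d) (charge t D (inner M (a, b)) + charge t D (inner M (b, c))
         + charge t D (inner M (c, d)) + s') * weight t Y (b, c) (charge t D (inner M (b, c)))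
       * context_weight t D s
     else 0)"
proof -
  have X: "site {(a, d), (b, c)}" by (simp add: site_def)
  have "(a, d) \<noteq> (b, c)" using less by auto
  then show ?thesis
    unfolding hook_expansion[OF X Y D] assms(3)
    by (simp add: assms(4) charge_nested[OF D Y] inner_gaps(2) charge_gap[OF D X Y]
      del: Un_insert_right)
qed

lemma hook_parallel:
  assumes D: "D \<subseteq> M" and Y: "Y \<subseteq> {(a, b), (c, d)}"
    and "charge t Y {(a, b), (c, d)} + 1 = s"
  shows "(1 - qpow (- 2)) * (\<Sum>x\<in>enclosing M D a d.
      qpow (int (position M D a d x) - 1 - int (dots_between D a d x))
      * amplitude t (M \<union> {(a, b), (c, d)}, insert x (D \<union> Y))) =
    (if charge t D M + s = 0
     then weight t Y (a, b) (charge t D (inner M (a, b)))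
       * weight t Y (c, d) (charge t D (inner M (c, d))) * context_weight t D s
     else 0)"
proof -
  have X: "site {(a, b), (c, d)}" by (simp add: site_def)
  have "(a, b) \<noteq> (c, d)" using less by auto
  then show ?thesis
    unfolding hook_expansion[OF X Y D] assms(3)
    by (simp add: inner_gaps(3,4) charge_gap[OF D X Y] del: Un_insert_right)
qed

lemma amplitude_type_I:
  assumes D: "D \<subseteq> M"
  shows "amplitude t (M \<union> {(a, d), (b, c)}, D \<union> {(b, c)}) =
    amplitude t (M \<union> {(a, b), (c, d)}, D \<union> {(a, b)})
    + amplitude t (M \<union> {(a, b), (c, d)}, D \<union> {(c, d)})
    + qpow (- 1) * amplitude t (M \<union> {(a, d), (b, c)}, D \<union> {(a, d)})
    + (1 - qpow (- 2)) * (\<Sum>x\<in>enclosing M D a d.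
        qpow (int (position M D a d x) - int (dots_between D a d x))
        * amplitude t (M \<union> {(a, b), (c, d)}, D \<union> {x}))"
proof -
  let ?\<beta> = "\<lambda>v. of_bool (v \<in> t) :: int"
  \<comment> \<open>Each diagram with one dot at the site has one undotted arc there, hence the -1.
    The dotless site has charge \<open>?s - 1\<close>, and the dot on an enclosing arc restores the
    difference. So all terms share one charge condition and one context factor.\<close>
  let ?s = "?\<beta> a + ?\<beta> b + ?\<beta> c + ?\<beta> d - 1"
  have c1: "charge t {(b, c)} {(a, d), (b, c)} = ?s" "charge t {(a, d)} {(a, d), (b, c)} = ?s"
      "charge t {(a, b)} {(a, b), (c, d)} = ?s" "charge t {(c, d)} {(a, b), (c, d)} = ?s"
      "charge t {} {(a, b), (c, d)} + 1 = ?s"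
      "charge t {(b, c)} {(b, c)} = ?\<beta> b + ?\<beta> c" "charge t {(a, d)} {(b, c)} = ?\<beta> b + ?\<beta> c - 1"
    using less by (simp_all add: charge_def del: of_bool_eq_iff sum_of_bool_eq)
  \<comment> \<open>The exponents of Type I are 1 larger than those of \<open>hook_parallel\<close>;
    the extracted \<open>qpow 1\<close> is the coefficient of the last term of
    \<open>type_I_local\<close>.\<close>
  have "qpow (int (position M D a d x) - int (dots_between D a d x)) =
    qpow 1 * qpow (int (position M D a d x) - 1 - int (dots_between D a d x))" for x
    by (simp add: qpow_mult)
  then have H: "(1 - qpow (- 2)) * (\<Sum>x\<in>enclosing M D a d.
        qpow (int (position M D a d x) - int (dots_between D a d x))
        * amplitude t (M \<union> {(a, b), (c, d)}, D \<union> {x}))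
    = qpow 1 * ((1 - qpow (- 2)) * (\<Sum>x\<in>enclosing M D a d.
      qpow (int (position M D a d x) - 1 - int (dots_between D a d x))
      * amplitude t (M \<union> {(a, b), (c, d)}, insert x (D \<union> {}))))"
    by (simp add: sum_distrib_left ac_simps del: amplitude.simps)
  note subs = amplitude_nested[OF D _ c1(1) c1(6)] amplitude_nested[OF D _ c1(2) c1(7)]
    amplitude_parallel[OF D _ c1(3)] amplitude_parallel[OF D _ c1(4)] hook_parallel[OF D _ c1(5)]
  show ?thesis
    unfolding H
    by (simp only: subs insert_subset empty_subsetI insert_iff simp_thms if_False if_True
        type_I_local[OF less] distrib_right mult.assoc if_distrib[of "times _"] mult_zero_right
        split: if_split)
      (simp add: algebra_simps)
qed

lemma amplitude_type_II:
  assumes D: "D \<subseteq> M"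
  shows "amplitude t (M \<union> {(a, b), (c, d)}, D \<union> {(a, b), (c, d)}) =
    amplitude t (M \<union> {(a, d), (b, c)}, D \<union> {(a, d), (b, c)})
    + (1 - qpow (- 2)) * (\<Sum>x\<in>enclosing M D a d.
        qpow (int (position M D a d x) - 1 - int (dots_between D a d x))
        * amplitude t (M \<union> {(a, d), (b, c)}, D \<union> {(a, d), x}))"
proof -
  let ?\<beta> = "\<lambda>v. of_bool (v \<in> t) :: int"
  \<comment> \<open>Both arcs at the site are dotted, so only the four ends count; in the sum the
    dot missing on bc is replaced by the one on \<open>x\<close>.\<close>
  let ?s = "?\<beta> a + ?\<beta> b + ?\<beta> c + ?\<beta> d"
  have c1: "charge t {(a, b), (c, d)} {(a, b), (c, d)} = ?s"
      "charge t {(a, d), (b, c)} {(a, d), (b, c)} = ?s"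
      "charge t {(a, d)} {(a, d), (b, c)} + 1 = ?s"
      "charge t {(a, d), (b, c)} {(b, c)} = ?\<beta> b + ?\<beta> c" "charge t {(a, d)} {(b, c)} = ?\<beta> b + ?\<beta> c - 1"
    using less by (simp_all add: charge_def)
  have "D \<union> {(a, d), x} = insert x (D \<union> {(a, d)})" for x by auto
  then have H: "(\<Sum>x\<in>enclosing M D a d.
        qpow (int (position M D a d x) - 1 - int (dots_between D a d x))
        * amplitude t (M \<union> {(a, d), (b, c)}, D \<union> {(a, d), x}))
    = (\<Sum>x\<in>enclosing M D a d.
        qpow (int (position M D a d x) - 1 - int (dots_between D a d x))
        * amplitude t (M \<union> {(a, d), (b, c)}, insert x (D \<union> {(a, d)})))"
    by (simp only:)
  note subs = amplitude_parallel[OF D _ c1(1)] amplitude_nested[OF D _ c1(2) c1(4)]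
    hook_nested[OF D _ c1(3) c1(5)]
  \<comment> \<open>\<open>m2\<close> is instantiated by hand, since it does not occur on the
    left-hand side of \<open>type_II_local\<close> and rewriting cannot find it.\<close>
  show ?thesis
    unfolding H
    by (cases "charge t D M + ?s = 0")
      (simp_all only: subs insert_subset empty_subsetI insert_iff simp_thms if_False if_True
        type_II_local[OF less, where ?m2.0 = "charge t D (inner M (b, c))"]
        distrib_right add_0_right)
qed

end

section \<open>Independence\<close>

definition evaluate :: "nat set \<Rightarrow> (diagram \<Rightarrow>\<^sub>0 laurent) \<Rightarrow> laurent" where
  "evaluate t v = (\<Sum>\<delta>\<in>Poly_Mapping.keys v. Poly_Mapping.lookup v \<delta> * amplitude t \<delta>)"

lemma evaluate_superset:
  assumes "finite S" "Poly_Mapping.keys v \<subseteq> S"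
  shows "evaluate t v = (\<Sum>\<delta>\<in>S. Poly_Mapping.lookup v \<delta> * amplitude t \<delta>)"
  unfolding evaluate_def
  by (rule sum.mono_neutral_left[OF assms]) (auto simp: in_keys_iff)

lemma evaluate_0 [simp]: "evaluate t 0 = 0"
  by (simp add: evaluate_def)

lemma evaluate_add: "evaluate t (v + w) = evaluate t v + evaluate t w"
proof -
  let ?S = "Poly_Mapping.keys v \<union> Poly_Mapping.keys w"
  show ?thesis
    using Poly_Mapping.keys_add[of v w]
    by (simp add: evaluate_superset[of ?S] lookup_add algebra_simps sum.distrib)
qed

lemma evaluate_cmul: "evaluate t (cmul r v) = r * evaluate t v"
  using evaluate_superset[of "Poly_Mapping.keys v" "cmul r v" t] keys_cmul[of r v]
  by (simp add: evaluate_def[of t v] sum_distrib_left mult.assoc)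

lemma evaluate_diff: "evaluate t (v - w) = evaluate t v - evaluate t w"
  using evaluate_add[of t "v - w" w] by simp

lemma evaluate_dg [simp]: "evaluate t (dg M D) = amplitude t (M, D)"
  by (simp add: evaluate_def dg_def del: amplitude.simps)

lemma evaluate_sum: "evaluate t (sum f A) = (\<Sum>x\<in>A. evaluate t (f x))"
  by (induction A rule: infinite_finite_induct) (simp_all add: evaluate_add)

lemma evaluate_relator:
  assumes "v \<in> russell_relators n k"
  shows "evaluate t v = 0"
proof -
  from assms consider
      (I) M D a b c d where "v = type_I_lhs M D a b c d - type_I_rhs M D a b c d"
        "admissible n M D a b c d"
    | (II) M D a b c d where "v = type_II_lhs M D a b c d - type_II_rhs M D a b c d"
        "admissible n M D a b c d"
    unfolding russell_relators_def by blast
  then show ?thesis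
  proof cases
    case I
    interpret relation_site n M a b c d
      using I(2) by unfold_locales (auto simp: admissible_def)
    have "D \<subseteq> M" using I(2) by (simp add: admissible_def)
    from amplitude_type_I[OF this, of t] show ?thesis
      unfolding I(1) type_I_lhs_def type_I_rhs_def evaluate_diff evaluate_add evaluate_cmul
        evaluate_sum evaluate_dg by simp
  next
    case II
    interpret relation_site n M a b c d
      using II(2) by unfold_locales (auto simp: admissible_def)
    have "D \<subseteq> M" using II(2) by (simp add: admissible_def)
    from amplitude_type_II[OF this, of t] show ?thesis
      unfolding II(1) type_II_lhs_def type_II_rhs_def evaluate_diff evaluate_add evaluate_cmul
        evaluate_sum evaluate_dg by simp
  qed
qed

section \<open>Outer diagrams and the left ends of their undotted arcs\<close>

definition openers :: "arc set \<Rightarrow> arc set \<Rightarrow> nat set" where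
  "openers M D = fst ` (M - D)"

lemma outer_diagramsD:
  assumes "(M, D) \<in> outer_diagrams n k"
  shows "crossingless_matching n M" "D \<subseteq> M" "card D = k" "finite M"
    "\<And>x y. x \<in> D \<Longrightarrow> y \<in> M \<Longrightarrow> \<not> (fst y < fst x \<and> snd x < snd y)"
  using assms finite_crossingless_matching[of n M]
  by (fastforce simp: outer_diagrams_def diagrams_def outer_arc_def)+

text \<open>An undotted arc with both ends in \<open>t\<close> has weight 0. If both ends are
  outside \<open>t\<close>, all arcs inside are undotted because dots are outer, so they contribute
  at most 0 each; with \<open>charge_nonneg\<close> the charge inside is 0 and the weight vanishes
  again. The undotted arcs therefore have charge 0 altogether, and total charge 0 leaves no right
  end of a dotted arc in \<open>t\<close>.\<close>

lemma outer_state: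
  assumes out: "(M, D) \<in> outer_diagrams n k" and nz: "amplitude t (M, D) \<noteq> 0"
  shows "\<And>x. x \<in> M - D \<Longrightarrow> (fst x \<in> t) \<noteq> (snd x \<in> t)"
    "\<And>x. x \<in> D \<Longrightarrow> fst x \<notin> t \<and> snd x \<notin> t"
proof -
  note o = outer_diagramsD[OF out]
  have ch: "charge t D M = 0" and sw: "state_weight t M D \<noteq> 0"
    using nz by (auto split: if_splits)
  have w: "weight t D x (charge t D (inner M x)) \<noteq> 0" if "x \<in> M" for x
    using sw o(4) that unfolding state_weight_def by (metis prod_zero)
  show und: "(fst x \<in> t) \<noteq> (snd x \<in> t)" if x: "x \<in> M - D" for x
  proof (rule ccontr)
    assume "\<not> (fst x \<in> t) \<noteq> (snd x \<in> t)"
    then have 0: "fst x \<notin> t" "snd x \<notin> t" using w[of x] x by (auto simp: weight_def)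
    have "inner M x \<subseteq> M - D" using x o(5)[of _ x] by (auto simp: inner_def)
    then have "charge t D (inner M x) \<le> 0"
      unfolding charge_def
      by (intro sum_nonpos) (use w in \<open>force simp: weight_def\<close>)
    moreover have "0 \<le> charge t D (inner M x)"
      by (rule charge_nonneg[OF o(1) sw]) (auto simp: inner_def)
    ultimately show False using w[of x] x 0 by (auto simp: weight_def)
  qed
  have fstD: "fst x \<notin> t" if "x \<in> D" for x using that w[of x] o(2) by (auto simp: weight_def)
  have "M - D \<union> D = M" using o(2) by auto
  then have "charge t D M = charge t D (M - D) + charge t D D"
    using charge_union[of "M - D" D t D] o(4) finite_subset[OF o(2,4)] by auto
  moreover have "charge t D (M - D) = 0"
    unfolding charge_def using und by (intro sum.neutral) auto
  moreover have "charge t D D = (\<Sum>x\<in>D. of_bool (snd x \<in> t))"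
    unfolding charge_def using fstD by (intro sum.cong) auto
  ultimately have "(\<Sum>x\<in>D. of_bool (snd x \<in> t) :: int) = 0" using ch by simp
  then have "\<forall>x\<in>D. of_bool (snd x \<in> t) = (0 :: int)"
    using finite_subset[OF o(2,4)] by (subst (asm) sum_nonneg_eq_0_iff) auto
  then show "fst x \<notin> t \<and> snd x \<notin> t" if "x \<in> D" for x using that fstD by auto
qed

text \<open>In this state every arc contributes charge 0, so every weight is \<open>qpow 0\<close>.
  These are the diagonal entries of the unitriangular matrix.\<close>

lemma amplitude_openers:
  assumes out: "(M, D) \<in> outer_diagrams n k"
  shows "amplitude (openers M D) (M, D) = 1"
proof -
  note o = outer_diagramsD[OF out]
  have und: "fst x \<in> openers M D" if "x \<in> M - D" for x using that by (auto simp: openers_def)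
  have snd: "snd x \<notin> openers M D" if x: "x \<in> M" for x
  proof
    assume "snd x \<in> openers M D"
    then obtain y where y: "y \<in> M" "snd x = fst y" by (auto simp: openers_def)
    then show False
      using matching_unique[OF o(1) x y(1), of "snd x"] matching_arc(2)[OF o(1) x] by auto
  qed
  have dot: "fst x \<notin> openers M D" if x: "x \<in> D" for x
  proof
    assume "fst x \<in> openers M D"
    then obtain y where y: "y \<in> M - D" "fst x = fst y" by (auto simp: openers_def)
    then show False
      using matching_unique[OF o(1), of x y "fst x"] x o(2) by auto
  qed
  have ch: "charge (openers M D) D A = 0" if "A \<subseteq> M" for A
    unfolding charge_def
  proof (intro sum.neutral ballI)
    fix x assume "x \<in> A"
    then show "of_bool (fst x \<in> openers M D) + of_bool (snd x \<in> openers M D) - of_bool (x \<notin> D) = (0::int)"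
      using that und[of x] snd[of x] dot[of x] by (cases "x \<in> D") auto
  qed
  have "weight (openers M D) D x (charge (openers M D) D (inner M x)) = 1" if x: "x \<in> M" for x
    using und[of x] snd[of x] dot[of x] x ch[of "inner M x"]
    by (cases "x \<in> D") (auto simp: weight_def qpow_0 inner_def)
  then show ?thesis by (simp add: ch state_weight_def)
qed

text \<open>By \<open>outer_state\<close>, \<open>t\<close> consists of one end \<open>f x\<close>
  of each undotted arc \<open>x\<close>, while \<open>openers\<close> takes the left end each time.
  Equality of the sums forces \<open>f x = fst x\<close> throughout.\<close>

lemma openers_minimal:
  assumes out: "(M, D) \<in> outer_diagrams n k" and nz: "amplitude t (M, D) \<noteq> 0"
    and t: "t \<subseteq> {1..2 * n}"
  shows "\<Sum>(openers M D) \<le> \<Sum>t" "\<Sum>t \<le> \<Sum>(openers M D) \<Longrightarrow> t = openers M D"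
proof -
  note o = outer_diagramsD[OF out] and st = outer_state[OF out nz]
  define f where "f = (\<lambda>x. if fst x \<in> t then fst x else snd x)"
  have f: "f x = fst x \<or> f x = snd x" for x by (simp add: f_def)
  have "t = f ` (M - D)"
  proof
    show "t \<subseteq> f ` (M - D)"
    proof
      fix v assume v: "v \<in> t"
      then have "1 \<le> v" "v \<le> 2 * n" using t by auto
      then obtain x where x: "x \<in> M" "v = fst x \<or> v = snd x"
        by (rule matching_cover[OF o(1)])
      have "x \<notin> D" using st(2)[of x] x v by auto
      then have "v = f x" using st(1)[of x] x v by (auto simp: f_def)
      then show "v \<in> f ` (M - D)" using x \<open>x \<notin> D\<close> by auto
    qed
    show "f ` (M - D) \<subseteq> t" using st(1) by (auto simp: f_def)
  qed
  moreover have "inj_on f (M - D)"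
    by (rule inj_onI) (metis DiffD1 f matching_unique[OF o(1)])
  ultimately have sumt: "\<Sum>t = sum f (M - D)" by (simp add: sum.reindex)
  have "inj_on fst (M - D)"
    by (rule inj_onI) (metis DiffD1 matching_unique[OF o(1)])
  then have sumo: "\<Sum>(openers M D) = sum fst (M - D)" by (simp add: openers_def sum.reindex)
  have le: "fst x \<le> f x" if "x \<in> M - D" for x
    using matching_arc(2)[OF o(1), of x] that by (auto simp: f_def)
  show "\<Sum>(openers M D) \<le> \<Sum>t" unfolding sumt sumo by (rule sum_mono[OF le])
  assume "\<Sum>t \<le> \<Sum>(openers M D)"
  then have eq: "sum fst (M - D) = sum f (M - D)"
    unfolding sumt sumo using sum_mono[of "M - D" fst f] le by fastforce
  have "f x = fst x" if "x \<in> M - D" for x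
  proof (rule ccontr)
    assume "f x \<noteq> fst x"
    then have "sum fst (M - D) < sum f (M - D)"
      using le that o(4) by (intro sum_strict_mono_ex1) (auto intro!: bexI[of _ x] simp: order.strict_iff_order)
    then show False using eq by simp
  qed
  then show "t = openers M D" using \<open>t = f ` (M - D)\<close> by (auto simp: openers_def image_iff)
qed

text \<open>Induction on the length of \<open>x\<close>, with the two diagrams interchanged in the
  induction hypothesis. Let \<open>z\<close> be the undotted arc of the second diagram with the same
  left end. If \<open>z\<close> is shorter, it is also an arc of the first diagram and must be
  \<open>x\<close>.\<close>

lemma undotted_determined:
  assumes "(M, D) \<in> outer_diagrams n k" "(M', D') \<in> outer_diagrams n k"
    and "openers M D = openers M' D'" "x \<in> M - D"
  shows "x \<in> M' - D'"
  using assms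
proof (induction "snd x - fst x" arbitrary: M D M' D' x rule: less_induct)
  case less
  note o = outer_diagramsD[OF less.prems(1)] and o' = outer_diagramsD[OF less.prems(2)]
  note eq = less.prems(3)
  have IH: "y \<in> M - D" if "snd y - fst y < snd x - fst x" "y \<in> M' - D'" for y
    using less.hyps[OF that(1) less.prems(2,1) eq[symmetric] that(2)] .
  have xM: "x \<in> M" "fst x < snd x" using less.prems(4) matching_arc(2)[OF o(1), of x] by auto
  have "fst x \<in> openers M' D'" using less.prems(4) unfolding eq[symmetric] by (auto simp: openers_def)
  then obtain z where z: "z \<in> M' - D'" "fst z = fst x" by (auto simp: openers_def)
  have z': "fst z < snd z" using z matching_arc(2)[OF o'(1), of z] by auto
  consider "snd z < snd x" | "snd z = snd x" | "snd x < snd z" by linarith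
  then show ?case
  proof cases
    case 1
    then have "z \<in> M" using IH[of z] z z' by auto
    then have "z = x" using matching_unique[OF o(1) _ xM(1), of z "fst x"] z by auto
    then show ?thesis using z by simp
  next
    case 2
    then have "z = x" using z by (simp add: prod_eq_iff)
    then show ?thesis using z by simp
  next
    case 3
    \<comment> \<open>If \<open>z\<close> is longer, the arc \<open>y\<close> of \<open>M'\<close>
      at the right end of \<open>x\<close> lies below \<open>z\<close>, so it is undotted. It cannot
      start there, since a common opener would be a left end in \<open>M\<close>; if it ends there,
      it is shorter than \<open>x\<close> and the induction hypothesis applies.\<close>
    obtain y where y: "y \<in> M'" "snd x = fst y \<or> snd x = snd y"
      using matching_cover[OF o'(1), of "snd x"] matching_arc[OF o(1) xM(1)] by auto
    have y': "fst y < snd y" using matching_arc(2)[OF o'(1) y(1)] .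
    have "y \<noteq> z" using y 3 xM z by auto
    have zM: "z \<in> M'" using z by auto
    have "fst z < fst y \<and> snd y < snd z"
      using matching_uncrossed[OF o'(1) zM y(1)] matching_uncrossed[OF o'(1) y(1) zM]
        matching_disjoint[OF o'(1) y(1) zM \<open>y \<noteq> z\<close>] y 3 xM z y' by linarith
    then have "y \<notin> D'" using o'(5)[of y z] zM by auto
    from y(2) show ?thesis
    proof
      assume e: "snd x = fst y"
      then have "snd x \<in> openers M D" using y \<open>y \<notin> D'\<close> unfolding eq by (auto simp: openers_def)
      then obtain u where u: "u \<in> M" "fst u = snd x" by (auto simp: openers_def)
      then have "u = x" using matching_unique[OF o(1) u(1) xM(1), of "snd x"] by auto
      then show ?thesis using u xM by auto
    next
      assume e: "snd x = snd y"
      have "y \<in> M"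
        using IH[of y] y \<open>y \<notin> D'\<close> e z y' \<open>fst z < fst y \<and> snd y < snd z\<close> by auto
      then have "y = x" using matching_unique[OF o(1) _ xM(1), of y "snd x"] e by auto
      then show ?thesis using y \<open>y \<notin> D'\<close> by auto
    qed
  qed
qed

text \<open>The dotted arcs of both diagrams match up the same set of points, and being outer they
  are not nested in each other. So they join consecutive points of this set, which determines them
  from left to right.\<close>

lemma dotted_determined:
  assumes "(M, D) \<in> outer_diagrams n k" "(M', D') \<in> outer_diagrams n k"
    and "M - D = M' - D'" "x \<in> D"
  shows "x \<in> D'"
  using assms
proof (induction "fst x" arbitrary: M D M' D' x rule: less_induct)
  case less
  note o = outer_diagramsD[OF less.prems(1)] and o' = outer_diagramsD[OF less.prems(2)]
  have partner: "\<exists>y\<in>E'. v = fst y \<or> v = snd y"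
    if asm: "(N, E) \<in> outer_diagrams n k" "(N', E') \<in> outer_diagrams n k" "N - E = N' - E'"
      "u \<in> E" "v = fst u \<or> v = snd u" for N E N' E' u v
  proof -
    note p = outer_diagramsD[OF asm(1)] and p' = outer_diagramsD[OF asm(2)]
    have uN: "u \<in> N" using asm p by auto
    have "1 \<le> v" "v \<le> 2 * n" using matching_arc[OF p(1) uN] asm(5) by auto
    then obtain y where y: "y \<in> N'" "v = fst y \<or> v = snd y"
      by (rule matching_cover[OF p'(1)])
    have "y \<in> E'"
    proof (rule ccontr)
      assume "y \<notin> E'"
      then have "y \<in> N - E" using y asm(3) by auto
      then show False using matching_unique[OF p(1) uN, of y v] y asm by auto
    qed
    then show ?thesis using y by blast
  qed
  \<comment> \<open>No end of a dotted arc lies strictly below another dotted arc; this decides the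
    comparison of right ends below.\<close>
  have not_inside: False
    if "(N, E) \<in> outer_diagrams n k" "u \<in> E" "y \<in> E" "fst u < v" "v < snd u"
      "v = fst y \<or> v = snd y" for N E u y v
  proof -
    note p = outer_diagramsD[OF that(1)]
    have uN: "u \<in> N" "y \<in> N" "y \<noteq> u" using that p by auto
    have "fst u < fst y \<and> snd y < snd u"
      using matching_uncrossed[OF p(1) uN(1,2)] matching_uncrossed[OF p(1) uN(2,1)]
        matching_disjoint[OF p(1) uN(2,1,3)] matching_arc(2)[OF p(1) uN(2)] that(4-) by linarith
    then show False using p(5)[OF that(3) uN(1)] by simp
  qed
  have xM: "x \<in> M" using less.prems(4) o(2) by auto
  have xx: "fst x < snd x" using matching_arc(2)[OF o(1) xM] .
  obtain y where y: "y \<in> D'" "fst x = fst y \<or> fst x = snd y"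
    using partner[OF less.prems, of "fst x"] by auto
  have yM: "y \<in> M'" using y o'(2) by auto
  have yy: "fst y < snd y" using matching_arc(2)[OF o'(1) yM] .
  from y(2) show ?case
  proof
    assume e: "fst x = fst y"
    consider "snd y < snd x" | "snd y = snd x" | "snd x < snd y" by linarith
    then show ?thesis
    proof cases
      case 1
      obtain z where "z \<in> D" "snd y = fst z \<or> snd y = snd z"
        using partner[OF less.prems(2,1) less.prems(3)[symmetric] y(1), of "snd y"] by auto
      then show ?thesis using not_inside[OF less.prems(1,4), of z "snd y"] 1 e yy by auto
    next
      case 2
      then show ?thesis using e y by (metis prod_eq_iff)
    next
      case 3
      obtain z where "z \<in> D'" "snd x = fst z \<or> snd x = snd z"
        using partner[OF less.prems, of "snd x"] by auto
      then show ?thesis using not_inside[OF less.prems(2) y(1), of z "snd x"] 3 e xx by auto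
    qed
  next
    assume e: "fst x = snd y"
    then have "y \<in> D"
      using less.hyps[OF _ less.prems(2,1) less.prems(3)[symmetric] y(1)] yy by auto
    then have "y \<in> M" using o(2) by auto
    then have "y = x" using matching_unique[OF o(1) _ xM, of y "fst x"] e by auto
    then show ?thesis using y by simp
  qed
qed

lemma openers_inj:
  assumes "(M, D) \<in> outer_diagrams n k" "(M', D') \<in> outer_diagrams n k"
    and "openers M D = openers M' D'"
  shows "(M, D) = (M', D')"
proof -
  have U: "M - D = M' - D'"
    using undotted_determined[OF assms] undotted_determined[OF assms(2,1) assms(3)[symmetric]] by blast
  then have "D = D'"
    using dotted_determined[OF assms(1,2) U] dotted_determined[OF assms(2,1) U[symmetric]] by blast
  then show ?thesis using U outer_diagramsD(2)[OF assms(1)] outer_diagramsD(2)[OF assms(2)] by auto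
qed

text \<open>Take a diagram in the support whose openers have the smallest sum and evaluate at these
  openers. By \<open>openers_minimal\<close> and \<open>openers_inj\<close> no other diagram of the
  support contributes, so its coefficient is 0.\<close>

lemma outer_independent:
  assumes keys: "Poly_Mapping.keys v \<subseteq> outer_diagrams n k" and "\<And>t. evaluate t v = 0"
  shows "v = 0"
proof (rule ccontr)
  assume "v \<noteq> 0"
  define s where "s = (\<lambda>(M, D). \<Sum>(openers M D))"
  have ne: "Poly_Mapping.keys v \<noteq> {}" using \<open>v \<noteq> 0\<close> by simp
  then have "Min (s ` Poly_Mapping.keys v) \<in> s ` Poly_Mapping.keys v" by (intro Min_in) auto
  then obtain \<delta> where \<delta>: "\<delta> \<in> Poly_Mapping.keys v" "s \<delta> = Min (s ` Poly_Mapping.keys v)" by auto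
  obtain M D where MD: "\<delta> = (M, D)" by (cases \<delta>)
  have out: "(M, D) \<in> outer_diagrams n k" using \<delta> keys MD by auto
  let ?t = "openers M D"
  have t: "?t \<subseteq> {1..2 * n}"
    using matching_arc[OF outer_diagramsD(1)[OF out]] by (fastforce simp: openers_def)
  have "amplitude ?t \<delta>' = 0" if \<delta>': "\<delta>' \<in> Poly_Mapping.keys v" "\<delta>' \<noteq> \<delta>" for \<delta>'
  proof (rule ccontr)
    assume nz: "amplitude ?t \<delta>' \<noteq> 0"
    obtain M' D' where MD': "\<delta>' = (M', D')" by (cases \<delta>')
    have out': "(M', D') \<in> outer_diagrams n k" using \<delta>' keys MD' by auto
    have "s \<delta> \<le> s \<delta>'" unfolding \<delta>(2) using \<delta>'(1) by simp
    then have "?t = openers M' D'"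
      using openers_minimal(2)[OF out' nz[unfolded MD'] t] by (simp add: s_def MD MD')
    then show False using openers_inj[OF out out'] \<delta>'(2) MD MD' by simp
  qed
  then have "evaluate ?t v = Poly_Mapping.lookup v \<delta> * amplitude ?t \<delta>"
    unfolding evaluate_def by (subst sum.remove[OF _ \<delta>(1)]) auto
  then show False
    using assms(2)[of ?t] \<delta>(1) amplitude_openers[OF out] by (simp add: MD in_keys_iff del: amplitude.simps)
qed

section \<open>Spanning\<close>

text \<open>A sum of indicators instead of a cardinality, so that the contributions of the two arcs
  at a site split off additively in \<open>depth_site\<close>.\<close>

definition depth :: "arc set \<Rightarrow> arc \<Rightarrow> nat" where
  "depth M x = (\<Sum>y\<in>M. of_bool (fst y < fst x \<and> snd x < snd y))"

context relation_site
begin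

lemma depth_site:
  "depth (M \<union> {(a, d), (b, c)}) x =
    depth M x + of_bool (a < fst x \<and> snd x < d) + of_bool (b < fst x \<and> snd x < c)"
  "depth (M \<union> {(a, b), (c, d)}) x =
    depth M x + of_bool (a < fst x \<and> snd x < b) + of_bool (c < fst x \<and> snd x < d)"
  using less notin_M by (simp_all add: depth_def)

lemma depth_M:
  assumes "e \<in> {(a, b), (c, d), (a, d), (b, c)}"
  shows "depth M e = card encl"
proof -
  have "fst y < fst e \<and> snd e < snd y \<longleftrightarrow> y \<in> encl" if "y \<in> M" for y
    using encloses_site[OF that, of "{(a, d), (b, c)}" e] encloses_site[OF that, of "{(a, b), (c, d)}" e]
      assms by (auto simp: site_def)
  then have "depth M e = (\<Sum>y\<in>M. of_bool (y \<in> encl))"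
    unfolding depth_def by (intro sum.cong) auto
  also have "M \<inter> {y. y \<in> encl} = encl" by (auto simp: encl_def)
  then have "(\<Sum>y\<in>M. of_bool (y \<in> encl)) = card encl" by (simp add: sum_of_bool_eq)
  finally show ?thesis .
qed

text \<open>The intervals ab and cd are disjoint and both lie below ad, so an arc gains at most one
  of them and then loses ad.\<close>

lemma depth_parallel_le:
  assumes "x \<in> M"
  shows "depth (M \<union> {(a, b), (c, d)}) x \<le> depth (M \<union> {(a, d), (b, c)}) x"
  using less arc_M[OF assms] unfolding depth_site by auto

text \<open>Whatever encloses \<open>x\<close> also encloses ad. The bound is below the depth
  \<open>card encl + 1\<close> of bc in the nested diagram, so moving the dot from bc to
  \<open>x\<close> decreases the total depth.\<close>

lemma depth_encl:
  assumes "x \<in> encl"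
  shows "depth (M \<union> {(a, b), (c, d)}) x \<le> card encl"
    "depth (M \<union> {(a, d), (b, c)}) x \<le> card encl"
proof -
  have "depth M x \<le> depth M (a, d)"
    unfolding depth_def using assms by (intro sum_mono) (auto simp: encl_def)
  then have "depth M x \<le> card encl" using depth_M[of "(a, d)"] by simp
  then show "depth (M \<union> {(a, b), (c, d)}) x \<le> card encl"
    "depth (M \<union> {(a, d), (b, c)}) x \<le> card encl"
    using assms less unfolding depth_site by (auto simp: encl_def)
qed

end

section \<open>Exchanging two nested arcs for two parallel ones\<close>

lemma crossingless_matchingI:
  assumes "\<And>x. x \<in> M \<Longrightarrow> 1 \<le> fst x \<and> fst x < snd x \<and> snd x \<le> 2 * n"
    "\<And>v. 1 \<le> v \<Longrightarrow> v \<le> 2 * n \<Longrightarrow> \<exists>x\<in>M. v = fst x \<or> v = snd x"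
    "\<And>x y v. x \<in> M \<Longrightarrow> y \<in> M \<Longrightarrow> v = fst x \<or> v = snd x \<Longrightarrow> v = fst y \<or> v = snd y \<Longrightarrow> x = y"
    "\<And>x y. x \<in> M \<Longrightarrow> y \<in> M \<Longrightarrow> \<not> (fst x < fst y \<and> fst y < snd x \<and> snd x < snd y)"
  shows "crossingless_matching n M"
proof -
  have "\<exists>!e. e \<in> M \<and> (v = fst e \<or> v = snd e)" if "v \<in> {1..2 * n}" for v
    using assms(2)[of v] assms(3)[of _ _ v] that by (metis atLeastAtMost_iff)
  moreover have "\<forall>(p, p')\<in>M. 1 \<le> p \<and> p < p' \<and> p' \<le> 2 * n" using assms(1) by fastforce
  moreover have "\<not> (\<exists>(p, p')\<in>M. \<exists>(r, r')\<in>M. p < r \<and> r < p' \<and> p' < r')"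
    using assms(4) by fastforce
  ultimately show ?thesis unfolding crossingless_matching_def by blast
qed

text \<open>An arc that crosses ab or cd but neither ad nor bc must lie between ad and bc, and
  \<open>gap\<close> excludes this: ad is the arc immediately around bc.\<close>

lemma exchange_admissible:
  assumes M: "crossingless_matching n M" and bc: "(b, c) \<in> M" and ad: "(a, d) \<in> M"
    and lt: "a < b" "c < d"
    and gap: "\<And>y. y \<in> M \<Longrightarrow> a < fst y \<Longrightarrow> fst y < b \<Longrightarrow> c < snd y \<Longrightarrow> False"
  defines "N \<equiv> M - {(a, d), (b, c)}"
  assumes D: "D \<subseteq> N"
  shows "admissible n N D a b c d"
proof -
  have MN: "N \<union> {(a, d), (b, c)} = M" using bc ad by (auto simp: N_def)
  have bc': "b < c" using matching_arc(2)[OF M bc] by simp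
  have bounds: "1 \<le> a" "d \<le> 2 * n" using matching_arc[OF M ad] by auto
  have ends: "fst y \<notin> {a, b, c, d}" "snd y \<notin> {a, b, c, d}" if "y \<in> N" for y
  proof -
    have "y \<in> M" "y \<noteq> (a, d)" "y \<noteq> (b, c)" using that by (auto simp: N_def)
    then show "fst y \<notin> {a, b, c, d}" "snd y \<notin> {a, b, c, d}"
      using matching_disjoint[OF M _ ad, of y] matching_disjoint[OF M _ bc, of y] by auto
  qed
  have "crossingless_matching n (N \<union> {(a, b), (c, d)})" (is "crossingless_matching n ?P")
  proof (rule crossingless_matchingI)
    fix x assume "x \<in> ?P"
    then show "1 \<le> fst x \<and> fst x < snd x \<and> snd x \<le> 2 * n"
      using matching_arc[OF M, of x] lt bc' bounds by (auto simp: N_def)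
  next
    fix v assume v: "1 \<le> v" "v \<le> 2 * n"
    show "\<exists>x\<in>?P. v = fst x \<or> v = snd x"
    proof (cases "v \<in> {a, b, c, d}")
      case True
      then show ?thesis by auto
    next
      case False
      obtain x where x: "x \<in> M" "v = fst x \<or> v = snd x" using matching_cover[OF M v] .
      then have "x \<in> N" using False by (auto simp: N_def)
      then show ?thesis using x by blast
    qed
  next
    fix x y v assume xy: "x \<in> ?P" "y \<in> ?P" and v: "v = fst x \<or> v = snd x" "v = fst y \<or> v = snd y"
    show "x = y"
    proof (cases "v \<in> {a, b, c, d}")
      case True
      then have "x \<notin> N" "y \<notin> N" using ends v by metis+
      then show ?thesis using xy v lt bc' by auto
    next
      case False
      then have "x \<in> M" "y \<in> M" using xy v by (auto simp: N_def)
      then show ?thesis using matching_unique[OF M] v by blast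
    qed
  next
    fix x y assume xy: "x \<in> ?P" "y \<in> ?P"
    have old: "\<not> (fst e < fst z \<and> fst z < snd e \<and> snd e < snd z) \<and>
        \<not> (fst z < fst e \<and> fst e < snd z \<and> snd z < snd e)"
      if z: "z \<in> N" and e: "e \<in> {(a, b), (c, d)}" for z e
    proof -
      have zM: "z \<in> M" using z by (auto simp: N_def)
      have ne: "fst z \<noteq> a" "fst z \<noteq> b" "fst z \<noteq> c" "fst z \<noteq> d"
        "snd z \<noteq> a" "snd z \<noteq> b" "snd z \<noteq> c" "snd z \<noteq> d" using ends[OF z] by auto
      have un: "\<not> (a < fst z \<and> fst z < d \<and> d < snd z)" "\<not> (fst z < a \<and> a < snd z \<and> snd z < d)"
        "\<not> (b < fst z \<and> fst z < c \<and> c < snd z)" "\<not> (fst z < b \<and> b < snd z \<and> snd z < c)"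
        using matching_uncrossed[OF M zM ad] matching_uncrossed[OF M ad zM]
          matching_uncrossed[OF M zM bc] matching_uncrossed[OF M bc zM] by auto
      have g: "\<not> (a < fst z \<and> fst z < b \<and> c < snd z)" using gap[OF zM] by blast
      from e consider "e = (a, b)" | "e = (c, d)" by auto
      then show ?thesis
      proof cases
        case 1
        have "\<not> (a < fst z \<and> fst z < b \<and> b < snd z)"
          using un(4) g ne(7) by linarith
        moreover have "\<not> (fst z < a \<and> a < snd z \<and> snd z < b)"
          using un(2) lt bc' by linarith
        ultimately show ?thesis using 1 by simp
      next
        case 2
        have "\<not> (c < fst z \<and> fst z < d \<and> d < snd z)"
          using un(1) lt bc' by linarith
        moreover have "\<not> (fst z < c \<and> c < snd z \<and> snd z < d)"
          using un(2,3) g ne(1,2) lt bc' by linarith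
        ultimately show ?thesis using 2 by simp
      qed
    qed
    consider "x \<in> N" "y \<in> N" | "x \<in> N" "y \<in> {(a, b), (c, d)}" | "x \<in> {(a, b), (c, d)}" "y \<in> N"
      | "x \<in> {(a, b), (c, d)}" "y \<in> {(a, b), (c, d)}" using xy by blast
    then show "\<not> (fst x < fst y \<and> fst y < snd x \<and> snd x < snd y)"
    proof cases
      case 1
      then show ?thesis using matching_uncrossed[OF M, of x y] by (auto simp: N_def)
    next
      case 2
      then show ?thesis using old[of x y] by blast
    next
      case 3
      then show ?thesis using old[of y x] by blast
    next
      case 4
      then show ?thesis using lt bc' by auto
    qed
  qed
  then show ?thesis using MN M lt bc' D by (auto simp: admissible_def)
qed

section \<open>Reduction to outer diagrams modulo the Russell relations\<close>

definition reduces :: "nat \<Rightarrow> nat \<Rightarrow> (diagram \<Rightarrow>\<^sub>0 laurent) \<Rightarrow> bool" where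
  "reduces n k v \<longleftrightarrow>
     (\<exists>w. Poly_Mapping.keys w \<subseteq> outer_diagrams n k \<and> v - w \<in> russell_submodule n k)"

lemma russell_submodule_closed:
  shows "0 \<in> russell_submodule n k"
    "v \<in> russell_submodule n k \<Longrightarrow> w \<in> russell_submodule n k \<Longrightarrow> v + w \<in> russell_submodule n k"
    "v \<in> russell_submodule n k \<Longrightarrow> cmul r v \<in> russell_submodule n k"
    "v \<in> russell_relators n k \<Longrightarrow> v \<in> russell_submodule n k"
proof -
  interpret submodule laurent_ring "russell_submodule n k" "free_diagram_module n k"
    by (rule submodule_russell_submodule)
  show "0 \<in> russell_submodule n k"
    using zero_closed module_free_diagram_module[of n k]
    by (simp add: free_diagram_module_def free_module_def)
  show "v \<in> russell_submodule n k \<Longrightarrow> w \<in> russell_submodule n k \<Longrightarrow> v + w \<in> russell_submodule n k"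
    using m_closed[of v w] by (simp add: free_diagram_module_def free_module_def)
  show "v \<in> russell_submodule n k \<Longrightarrow> cmul r v \<in> russell_submodule n k"
    using smult_closed[of r v]
    by (simp add: free_diagram_module_def free_module_def laurent_ring_def)
  show "v \<in> russell_relators n k \<Longrightarrow> v \<in> russell_submodule n k"
    using module.in_own_span[OF module_free_diagram_module russell_relators_closed, of n k]
    unfolding russell_submodule_def by blast
qed

lemma reduces_0: "reduces n k 0"
  unfolding reduces_def by (intro exI[of _ 0]) (simp add: russell_submodule_closed)

lemma reduces_add:
  assumes "reduces n k v" "reduces n k w"
  shows "reduces n k (v + w)"
proof -
  from assms obtain v' w' where
    v': "Poly_Mapping.keys v' \<subseteq> outer_diagrams n k" "v - v' \<in> russell_submodule n k" and
    w': "Poly_Mapping.keys w' \<subseteq> outer_diagrams n k" "w - w' \<in> russell_submodule n k"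
    unfolding reduces_def by blast
  show ?thesis
    unfolding reduces_def
  proof (intro exI conjI)
    show "Poly_Mapping.keys (v' + w') \<subseteq> outer_diagrams n k"
      using v' w' Poly_Mapping.keys_add[of v' w'] by blast
    show "v + w - (v' + w') \<in> russell_submodule n k"
      using russell_submodule_closed(2)[OF v'(2) w'(2)] by (simp add: algebra_simps)
  qed
qed

lemma cmul_diff: "cmul r (v - w) = cmul r v - cmul r w"
  by (rule poly_mapping_eqI) (simp add: lookup_minus algebra_simps)

lemma reduces_cmul:
  assumes "reduces n k v"
  shows "reduces n k (cmul r v)"
proof -
  from assms obtain v' where
    v': "Poly_Mapping.keys v' \<subseteq> outer_diagrams n k" "v - v' \<in> russell_submodule n k"
    unfolding reduces_def by blast
  then have "Poly_Mapping.keys (cmul r v') \<subseteq> outer_diagrams n k"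
    "cmul r v - cmul r v' \<in> russell_submodule n k"
    using keys_cmul[of r v'] russell_submodule_closed(3)[OF v'(2), of r] by (auto simp: cmul_diff)
  then show ?thesis unfolding reduces_def by blast
qed

lemma reduces_diff:
  assumes "reduces n k v" "reduces n k w"
  shows "reduces n k (v - w)"
proof -
  have "v - w = v + cmul (- 1) w"
    by (rule poly_mapping_eqI) (simp add: lookup_minus lookup_add)
  then show ?thesis using reduces_add[OF assms(1) reduces_cmul[OF assms(2)], of "- 1"] by (simp only:)
qed

lemma reduces_sum:
  "(\<And>x. x \<in> A \<Longrightarrow> reduces n k (f x)) \<Longrightarrow> reduces n k (sum f A)"
  by (induction A rule: infinite_finite_induct) (auto intro: reduces_0 reduces_add)

lemma reduces_submodule:
  assumes "v \<in> russell_submodule n k"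
  shows "reduces n k v"
  unfolding reduces_def by (intro exI[of _ 0]) (simp add: assms)

text \<open>Induction on the total depth of the dots. A dotted arc bc that is not outer has depth
  \<open>card encl + 1\<close>. Type I (if ad is undotted) or Type II read from right to left (if ad
  is dotted) moves its dot to an arc of depth at most \<open>card encl\<close>, and the other dots
  do not get deeper.\<close>

lemma reduces_diagram:
  assumes "(M, D) \<in> diagrams n k"
  shows "reduces n k (dg M D)"
  using assms
proof (induction "\<Sum>x\<in>D. depth M x" arbitrary: M D rule: less_induct)
  case less
  have M: "crossingless_matching n M" and DM: "D \<subseteq> M" and card: "card D = k"
    using less.prems by (auto simp: diagrams_def)
  have finM: "finite M" using M by (rule finite_crossingless_matching)
  have finD: "finite D" using DM finM by (rule finite_subset)
  show ?case
  proof (cases "\<forall>x\<in>D. outer_arc M x")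
    case True
    then have "(M, D) \<in> outer_diagrams n k" using less.prems by (simp add: outer_diagrams_def)
    then show ?thesis
      unfolding reduces_def by (intro exI[of _ "dg M D"]) (simp add: russell_submodule_closed)
  next
    case False
    then obtain b c where bc: "(b, c) \<in> D" "\<not> outer_arc M (b, c)" by auto
    \<comment> \<open>The arcs around bc are nested, so the largest left end selects the innermost
      one, which gives \<open>gap\<close>.\<close>
    define P where "P = {y \<in> M. fst y < b \<and> c < snd y}"
    have "P \<noteq> {}" using bc DM by (auto simp: outer_arc_def P_def)
    moreover have finP: "finite P" using finM by (simp add: P_def)
    ultimately have "Max (fst ` P) \<in> fst ` P" by (intro Max_in) auto
    then obtain a d where ad: "(a, d) \<in> P" "a = Max (fst ` P)" by auto
    have adM: "(a, d) \<in> M" "a < b" "c < d" using ad by (auto simp: P_def)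
    have bcM: "(b, c) \<in> M" using bc DM by auto
    have gap: False if "y \<in> M" "a < fst y" "fst y < b" "c < snd y" for y
    proof -
      have "y \<in> P" using that by (simp add: P_def)
      then have "fst y \<le> a" unfolding ad(2) using finP by simp
      then show False using that by simp
    qed
    define N where "N = M - {(a, d), (b, c)}"
    define E where "E = D - {(a, d), (b, c)}"
    have EN: "E \<subseteq> N" using DM by (auto simp: E_def N_def)
    have adm: "admissible n N E a b c d"
      using exchange_admissible[OF M bcM adM gap EN[unfolded N_def]] by (simp only: N_def)
    interpret relation_site n N a b c d
      using adm by unfold_locales (auto simp: admissible_def)
    have MN: "M = N \<union> {(a, d), (b, c)}" using bcM adM by (auto simp: N_def)
    have finE: "finite E" using finD by (simp add: E_def)
    have notE: "(a, b) \<notin> E" "(c, d) \<notin> E" "(a, d) \<notin> E" "(b, c) \<notin> E"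
      using notin_M EN by auto
    have dN: "depth (N \<union> {(a, d), (b, c)}) (a, d) = card encl"
      "depth (N \<union> {(a, d), (b, c)}) (b, c) = card encl + 1"
      "depth (N \<union> {(a, b), (c, d)}) (a, b) = card encl"
      "depth (N \<union> {(a, b), (c, d)}) (c, d) = card encl"
      unfolding depth_site using depth_M less by auto
    have sumE: "(\<Sum>x\<in>E. depth (N \<union> {(a, b), (c, d)}) x) \<le> (\<Sum>x\<in>E. depth (N \<union> {(a, d), (b, c)}) x)"
      using EN by (intro sum_mono depth_parallel_le) auto
    have ends: "(a, b) \<noteq> (c, d)" "(a, d) \<noteq> (b, c)" using less by auto
    have enc: "x \<in> encl \<and> x \<notin> E \<and> x \<in> N \<and> x \<noteq> (a, d)" if "x \<in> enclosing N E a d" for x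
      using that notin_M by (auto simp: enclosing_def encl_def)
    show ?thesis
    proof (cases "(a, d) \<in> D")
      case False
      have D: "D = E \<union> {(b, c)}" using bc False by (auto simp: E_def)
      have k: "card E + 1 = k" using card finE notE by (simp add: D)
      have lhs: "(\<Sum>x\<in>D. depth M x) = (\<Sum>x\<in>E. depth (N \<union> {(a, d), (b, c)}) x) + (card encl + 1)"
        unfolding D MN using finE notE dN(2) by simp
      have r1: "reduces n k (dg (N \<union> {(a, b), (c, d)}) (E \<union> {(a, b)}))"
        using finE notE dN(3) sumE parallel EN k
        by (intro less.hyps) (simp_all add: lhs diagrams_def, auto)
      have r2: "reduces n k (dg (N \<union> {(a, b), (c, d)}) (E \<union> {(c, d)}))"
        using finE notE dN(4) sumE parallel EN k
        by (intro less.hyps) (simp_all add: lhs diagrams_def, auto)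
      have r3: "reduces n k (dg (N \<union> {(a, d), (b, c)}) (E \<union> {(a, d)}))"
        using finE notE dN(1) nested EN k
        by (intro less.hyps) (simp_all add: lhs diagrams_def, auto)
      have r4: "reduces n k (dg (N \<union> {(a, b), (c, d)}) (E \<union> {x}))" if "x \<in> enclosing N E a d" for x
        using finE enc[OF that] depth_encl(1)[of x] sumE parallel EN k
        by (intro less.hyps) (simp_all add: lhs diagrams_def, auto)
      have "reduces n k (type_I_rhs N E a b c d)"
        unfolding type_I_rhs_def by (intro reduces_add reduces_cmul reduces_sum r1 r2 r3 r4)
      moreover have "type_I_lhs N E a b c d - type_I_rhs N E a b c d \<in> russell_relators n k"
        unfolding russell_relators_def using adm k by blast
      ultimately have "reduces n k ((type_I_lhs N E a b c d - type_I_rhs N E a b c d)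
          + type_I_rhs N E a b c d)"
        by (intro reduces_add[OF reduces_submodule[OF russell_submodule_closed(4)]])
      then show ?thesis by (simp add: type_I_lhs_def D MN)
    next
      case True
      have D: "D = E \<union> {(a, d), (b, c)}" using bc True by (auto simp: E_def)
      have k: "card E + 2 = k" using card finE notE ends by (simp add: D)
      have lhs: "(\<Sum>x\<in>D. depth M x)
          = (\<Sum>x\<in>E. depth (N \<union> {(a, d), (b, c)}) x) + (2 * card encl + 1)"
        unfolding D MN using finE notE dN(1,2) ends by simp
      have r1: "reduces n k (dg (N \<union> {(a, b), (c, d)}) (E \<union> {(a, b), (c, d)}))"
        using finE notE ends dN(3,4) sumE parallel EN k
        by (intro less.hyps) (simp_all add: lhs diagrams_def, auto)
      have r2: "reduces n k (dg (N \<union> {(a, d), (b, c)}) (E \<union> {(a, d), x}))"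
        if "x \<in> enclosing N E a d" for x
        using finE notE enc[OF that] dN(1) depth_encl(2)[of x] nested EN k
        by (intro less.hyps) (simp_all add: lhs diagrams_def, auto)
      have "reduces n k (cmul (1 - qpow (- 2)) (\<Sum>x\<in>enclosing N E a d.
            cmul (qpow (int (position N E a d x) - 1 - int (dots_between E a d x)))
              (dg (N \<union> {(a, d), (b, c)}) (E \<union> {(a, d), x}))))" (is "reduces n k ?S")
        by (intro reduces_cmul reduces_sum r2)
      moreover have "type_II_lhs N E a b c d - type_II_rhs N E a b c d \<in> russell_relators n k"
        unfolding russell_relators_def using adm k by blast
      \<comment> \<open>The expression is the first term of \<open>type_II_rhs\<close>, the given
        diagram, solved from the relation.\<close>
      ultimately have "reduces n k (type_II_lhs N E a b c d
          - (type_II_lhs N E a b c d - type_II_rhs N E a b c d) - ?S)"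
        unfolding type_II_lhs_def
        by (intro reduces_diff[OF reduces_diff[OF r1 reduces_submodule[OF russell_submodule_closed(4)]]])
      then show ?thesis by (simp add: type_II_rhs_def D MN)
    qed
  qed
qed

lemma monomial_expansion:
  "v = (\<Sum>\<delta>\<in>Poly_Mapping.keys v. cmul (Poly_Mapping.lookup v \<delta>) (Poly_Mapping.single \<delta> 1))"
  by (rule poly_mapping_eqI)
    (simp add: lookup_sum lookup_single when_def in_keys_iff if_distrib[of "times _"] cong: if_cong)

lemma reduces_all:
  assumes "Poly_Mapping.keys v \<subseteq> diagrams n k"
  shows "reduces n k v"
proof -
  have "reduces n k (\<Sum>\<delta>\<in>Poly_Mapping.keys v.
      cmul (Poly_Mapping.lookup v \<delta>) (Poly_Mapping.single \<delta> 1))"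
  proof (intro reduces_sum reduces_cmul)
    fix \<delta> assume "\<delta> \<in> Poly_Mapping.keys v"
    then show "reduces n k (Poly_Mapping.single \<delta> 1)"
      using reduces_diagram[of "fst \<delta>" "snd \<delta>" n k] assms by (auto simp: dg_def)
  qed
  then show ?thesis by (simp flip: monomial_expansion)
qed

section \<open>The quotient module\<close>

text \<open>Meaningful for every \<open>v\<close>, also with keys outside
  \<open>diagrams n k\<close>, so that the rules for sums and scalar multiples of cosets have no
  side conditions.\<close>

definition coset :: "nat \<Rightarrow> nat \<Rightarrow> (diagram \<Rightarrow>\<^sub>0 laurent) \<Rightarrow> (diagram \<Rightarrow>\<^sub>0 laurent) set" where
  "coset n k v = {x. x - v \<in> russell_submodule n k}"

lemma russell_submodule_uminus:
  "v \<in> russell_submodule n k \<Longrightarrow> - v \<in> russell_submodule n k"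
proof -
  have "cmul (- 1) v = - v" by (rule poly_mapping_eqI) simp
  then show "v \<in> russell_submodule n k \<Longrightarrow> - v \<in> russell_submodule n k"
    using russell_submodule_closed(3)[of v n k "- 1"] by simp
qed

lemma coset_rcos: "russell_submodule n k +>\<^bsub>free_diagram_module n k\<^esub> v = coset n k v"
proof
  show "russell_submodule n k +>\<^bsub>free_diagram_module n k\<^esub> v \<subseteq> coset n k v"
    by (auto simp: a_r_coset_def' coset_def free_diagram_module_def free_module_def)
  show "coset n k v \<subseteq> russell_submodule n k +>\<^bsub>free_diagram_module n k\<^esub> v"
    by (auto simp: a_r_coset_def' coset_def free_diagram_module_def free_module_def
        intro!: bexI[of _ "_ - v"])
qed

lemma coset_eq_iff: "coset n k v = coset n k w \<longleftrightarrow> v - w \<in> russell_submodule n k"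
proof
  assume "coset n k v = coset n k w"
  moreover have "v \<in> coset n k v" by (simp add: coset_def russell_submodule_closed)
  ultimately show "v - w \<in> russell_submodule n k" by (simp add: coset_def)
next
  assume vw: "v - w \<in> russell_submodule n k"
  have "x - w \<in> russell_submodule n k \<longleftrightarrow> x - v \<in> russell_submodule n k" for x
    using russell_submodule_closed(2)[OF _ vw, of "x - v"]
      russell_submodule_closed(2)[OF _ russell_submodule_uminus[OF vw], of "x - w"] by auto
  then show "coset n k v = coset n k w" by (simp add: coset_def)
qed

lemma coset_0: "coset n k 0 = russell_submodule n k"
  by (simp add: coset_def)

lemma carrier_quantum_russell_space:
  "carrier (quantum_russell_space n k) = coset n k ` {v. Poly_Mapping.keys v \<subseteq> diagrams n k}"
proof -
  have "carrier (quantum_russell_space n k) = a_rcosets\<^bsub>free_diagram_module n k\<^esub> russell_submodule n k"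
    by (simp add: quantum_russell_space_def quotient_module_def)
  moreover have "carrier (free_diagram_module n k) = {v. Poly_Mapping.keys v \<subseteq> diagrams n k}"
    by (simp add: free_diagram_module_def free_module_def)
  ultimately show ?thesis by (auto simp: A_RCOSETS_def' coset_rcos)
qed

lemma add_coset:
  "coset n k v \<oplus>\<^bsub>quantum_russell_space n k\<^esub> coset n k w = coset n k (v + w)"
proof -
  have "coset n k v <+>\<^bsub>free_diagram_module n k\<^esub> coset n k w = coset n k (v + w)"
  proof
    show "coset n k v <+>\<^bsub>free_diagram_module n k\<^esub> coset n k w \<subseteq> coset n k (v + w)"
    proof
      fix x assume "x \<in> coset n k v <+>\<^bsub>free_diagram_module n k\<^esub> coset n k w"
      then obtain y z where "y \<in> coset n k v" "z \<in> coset n k w" "x = y + z"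
        by (auto simp: set_add_def set_mult_def free_diagram_module_def free_module_def)
      then show "x \<in> coset n k (v + w)"
        using russell_submodule_closed(2)[of "y - v" n k "z - w"]
        by (simp add: coset_def algebra_simps)
    qed
    show "coset n k (v + w) \<subseteq> coset n k v <+>\<^bsub>free_diagram_module n k\<^esub> coset n k w"
    proof
      fix x assume "x \<in> coset n k (v + w)"
      then have "x - w \<in> coset n k v" "w \<in> coset n k w"
        by (simp_all add: coset_def russell_submodule_closed algebra_simps)
      then have "\<exists>y\<in>coset n k v. \<exists>z\<in>coset n k w. x = y + z"
        by (metis diff_add_cancel)
      then show "x \<in> coset n k v <+>\<^bsub>free_diagram_module n k\<^esub> coset n k w"
        by (auto simp: set_add_def set_mult_def free_diagram_module_def free_module_def)
    qed
  qed
  then show ?thesis by (simp add: quantum_russell_space_def quotient_module_def)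
qed

lemma smult_coset: "r \<odot>\<^bsub>quantum_russell_space n k\<^esub> coset n k v = coset n k (cmul r v)"
proof -
  have "coset n k (cmul r x) = coset n k (cmul r v)" if "x \<in> coset n k v" for x
    using that russell_submodule_closed(3)[of "x - v" n k r]
    by (simp add: coset_eq_iff cmul_diff) (simp add: coset_def cmul_diff)
  moreover have "v \<in> coset n k v" by (simp add: coset_def russell_submodule_closed)
  ultimately have "(\<Union>x\<in>coset n k v. coset n k (cmul r x)) = coset n k (cmul r v)" by blast
  moreover have "r \<odot>\<^bsub>quantum_russell_space n k\<^esub> coset n k v
      = (\<Union>x\<in>coset n k v. coset n k (cmul r x))"
    by (simp add: quantum_russell_space_def quotient_module_def coset_rcos)
      (simp add: free_diagram_module_def free_module_def)
  ultimately show ?thesis by simp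
qed

lemma zero_quantum_russell_space: "\<zero>\<^bsub>quantum_russell_space n k\<^esub> = coset n k 0"
  by (simp add: quantum_russell_space_def quotient_module_def coset_0)

lemma diagram_class_coset: "diagram_class n k \<delta> = coset n k (Poly_Mapping.single \<delta> 1)"
  by (simp add: diagram_class_def coset_rcos)

text \<open>The kernel of the functional is a submodule that contains the relators, hence it
  contains their span.\<close>

lemma evaluate_russell_submodule:
  assumes "v \<in> russell_submodule n k"
  shows "evaluate t v = 0"
proof -
  let ?K = "{v \<in> carrier (free_diagram_module n k). evaluate t v = 0}"
  interpret Module.module laurent_ring "free_diagram_module n k"
    by (rule module_free_diagram_module)
  have "submodule laurent_ring ?K (free_diagram_module n k)"
  proof (unfold_locales)
    show "\<zero>\<^bsub>free_diagram_module n k\<^esub> \<in> ?K"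
      using M.zero_closed by (simp add: free_diagram_module_def free_module_def)
  next
    fix x y assume x: "x \<in> ?K" and y: "y \<in> ?K"
    have "evaluate t (x \<oplus>\<^bsub>free_diagram_module n k\<^esub> y) = 0"
      using x y by (simp add: free_diagram_module_def free_module_def evaluate_add)
    then show "x \<oplus>\<^bsub>free_diagram_module n k\<^esub> y \<in> ?K" using x y by simp
  next
    fix r x assume r: "r \<in> carrier laurent_ring" and x: "x \<in> ?K"
    have "evaluate t (r \<odot>\<^bsub>free_diagram_module n k\<^esub> x) = 0"
      using x by (simp add: free_diagram_module_def free_module_def evaluate_cmul)
    then show "r \<odot>\<^bsub>free_diagram_module n k\<^esub> x \<in> ?K" using r x by simp
  qed auto
  moreover have "russell_relators n k \<subseteq> ?K"
    using russell_relators_closed evaluate_relator by auto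
  ultimately have "russell_submodule n k \<subseteq> ?K"
    unfolding russell_submodule_def by (intro span_is_subset)
  then show ?thesis using assms by auto
qed

lemma outer_combination_0:
  assumes "Poly_Mapping.keys v \<subseteq> outer_diagrams n k" "v \<in> russell_submodule n k"
  shows "v = 0"
  using outer_independent[OF assms(1)] evaluate_russell_submodule[OF assms(2)] by blast

lemma keys_single_combination:
  assumes "f ` A \<subseteq> S"
  shows "Poly_Mapping.keys (\<Sum>x\<in>A. cmul (a x) (Poly_Mapping.single (f x) 1)) \<subseteq> S"
  using assms by (intro keys_sum_subset order_trans[OF keys_cmul]) auto

lemma outer_diagrams_subset: "outer_diagrams n k \<subseteq> diagrams n k"
  by (auto simp: outer_diagrams_def)

lemma diagram_class_inj: "inj_on (diagram_class n k) (outer_diagrams n k)"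
proof (rule inj_onI)
  fix \<delta> \<epsilon> assume d: "\<delta> \<in> outer_diagrams n k" and e: "\<epsilon> \<in> outer_diagrams n k"
    and "diagram_class n k \<delta> = diagram_class n k \<epsilon>"
  then have "Poly_Mapping.single \<delta> 1 - Poly_Mapping.single \<epsilon> 1 \<in> russell_submodule n k"
    by (simp add: diagram_class_coset coset_eq_iff)
  moreover have "Poly_Mapping.keys (Poly_Mapping.single \<delta> 1 - Poly_Mapping.single \<epsilon> (1 :: laurent))
      \<subseteq> outer_diagrams n k"
    using d e Poly_Mapping.keys_diff[of "Poly_Mapping.single \<delta> 1" "Poly_Mapping.single \<epsilon> (1 :: laurent)"]
    by auto
  ultimately have "Poly_Mapping.single \<delta> 1 - Poly_Mapping.single \<epsilon> (1 :: laurent) = 0"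
    by (intro outer_combination_0)
  then have "Poly_Mapping.keys (Poly_Mapping.single \<delta> (1 :: laurent))
      = Poly_Mapping.keys (Poly_Mapping.single \<epsilon> (1 :: laurent))" by simp
  then show "\<delta> = \<epsilon>" by simp
qed

section \<open>The basis property in the quotient\<close>

context
  fixes n k :: nat
begin

interpretation Q: Module.module laurent_ring "quantum_russell_space n k"
  by (rule module_quantum_russell_space)

lemma outer_classes_carrier: "outer_classes n k \<subseteq> carrier (quantum_russell_space n k)"
  using outer_diagrams_subset[of n k]
  by (auto simp: outer_classes_def diagram_class_coset carrier_quantum_russell_space)

text \<open>The choice \<open>f\<close> of a diagram in each class lifts linear combinations to the
  free module, where the functionals and the reduction live.\<close>

lemma lincomb_diagram_classes:
  assumes "finite A" "f ` A \<subseteq> outer_diagrams n k" "\<And>X. X \<in> A \<Longrightarrow> X = diagram_class n k (f X)"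
  shows "Q.lincomb a A = coset n k (\<Sum>X\<in>A. cmul (a X) (Poly_Mapping.single (f X) 1))"
  using assms
proof (induction A rule: finite_induct)
  case empty
  then show ?case by (simp add: Q.lincomb_def zero_quantum_russell_space)
next
  case (insert X A)
  have "Y \<in> outer_classes n k" if "Y \<in> insert X A" for Y
    using insert.prems(1) insert.prems(2)[OF that] that by (auto simp: outer_classes_def)
  then have sub: "insert X A \<subseteq> carrier (quantum_russell_space n k)"
    using outer_classes_carrier by blast
  have "Q.lincomb a (insert X A)
      = a X \<odot>\<^bsub>quantum_russell_space n k\<^esub> X \<oplus>\<^bsub>quantum_russell_space n k\<^esub> Q.lincomb a A"
    using insert.hyps sub by (intro Q.lincomb_insert2) (auto simp: laurent_ring_def)
  also have "a X \<odot>\<^bsub>quantum_russell_space n k\<^esub> X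
      = coset n k (cmul (a X) (Poly_Mapping.single (f X) 1))"
    using insert.prems(2)[of X] smult_coset[of n k "a X" "Poly_Mapping.single (f X) 1"]
    by (simp add: diagram_class_coset)
  also have "Q.lincomb a A = coset n k (\<Sum>X\<in>A. cmul (a X) (Poly_Mapping.single (f X) 1))"
    using insert by auto
  finally show ?case using insert.hyps by (simp add: add_coset)
qed

lemma outer_classes_lin_indpt: "\<not> Q.lin_dep (outer_classes n k)"
proof
  assume "Q.lin_dep (outer_classes n k)"
  moreover have "\<zero>\<^bsub>laurent_ring\<^esub> = 0" by (simp add: laurent_ring_def)
  ultimately obtain A a X where A: "finite A" "A \<subseteq> outer_classes n k"
    and zero: "Q.lincomb a A = \<zero>\<^bsub>quantum_russell_space n k\<^esub>"
    and X: "X \<in> A" "a X \<noteq> 0"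
    unfolding Q.lin_dep_def by auto
  have "\<forall>Y\<in>A. \<exists>\<delta>. \<delta> \<in> outer_diagrams n k \<and> Y = diagram_class n k \<delta>"
    using A by (fastforce simp: outer_classes_def)
  then obtain f where f: "\<And>Y. Y \<in> A \<Longrightarrow> f Y \<in> outer_diagrams n k"
    "\<And>Y. Y \<in> A \<Longrightarrow> Y = diagram_class n k (f Y)" by metis
  define v where "v = (\<Sum>Y\<in>A. cmul (a Y) (Poly_Mapping.single (f Y) 1))"
  have "coset n k v = coset n k 0"
    using lincomb_diagram_classes[of A f a] A f zero
    by (simp add: v_def zero_quantum_russell_space image_subset_iff)
  then have "v \<in> russell_submodule n k" by (simp add: coset_eq_iff)
  moreover have "Poly_Mapping.keys v \<subseteq> outer_diagrams n k"
    unfolding v_def using f by (intro keys_single_combination) auto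
  ultimately have "v = 0" by (intro outer_combination_0)
  moreover have "Poly_Mapping.lookup v (f X) = a X"
  proof -
    \<comment> \<open>Different classes have different representatives, so the coefficients do not
      collide in the lift.\<close>
    have "f Y = f X \<longleftrightarrow> Y = X" if "Y \<in> A" for Y
      using f(2)[OF that] f(2)[OF X(1)] by metis
    then have "Poly_Mapping.lookup v (f X) = (\<Sum>Y\<in>A. if Y = X then a Y else 0)"
      unfolding v_def by (auto simp: lookup_sum lookup_single when_def intro!: sum.cong)
    then show ?thesis using A X by simp
  qed
  ultimately show False using X by simp
qed

lemma outer_classes_span: "Q.span (outer_classes n k) = carrier (quantum_russell_space n k)"
proof
  show "Q.span (outer_classes n k) \<subseteq> carrier (quantum_russell_space n k)"
    by (rule Q.span_is_subset2[OF outer_classes_carrier])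
  show "carrier (quantum_russell_space n k) \<subseteq> Q.span (outer_classes n k)"
  proof
    fix X assume "X \<in> carrier (quantum_russell_space n k)"
    then obtain v where v: "Poly_Mapping.keys v \<subseteq> diagrams n k" "X = coset n k v"
      by (auto simp: carrier_quantum_russell_space)
    obtain w where w: "Poly_Mapping.keys w \<subseteq> outer_diagrams n k" "v - w \<in> russell_submodule n k"
      using reduces_all[OF v(1)] by (auto simp: reduces_def)
    have inj: "inj_on (diagram_class n k) (Poly_Mapping.keys w)"
      using diagram_class_inj w(1) by (rule inj_on_subset)
    define A where "A = diagram_class n k ` Poly_Mapping.keys w"
    define f where "f = inv_into (Poly_Mapping.keys w) (diagram_class n k)"
    have f: "f (diagram_class n k \<delta>) = \<delta>" if "\<delta> \<in> Poly_Mapping.keys w" for \<delta>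
      unfolding f_def using inj that by (rule inv_into_f_f)
    have A: "finite A" "A \<subseteq> outer_classes n k" using w(1) by (auto simp: A_def outer_classes_def)
    have "Q.lincomb (\<lambda>Y. Poly_Mapping.lookup w (f Y)) A
      = coset n k (\<Sum>Y\<in>A. cmul (Poly_Mapping.lookup w (f Y)) (Poly_Mapping.single (f Y) 1))"
      using w(1) f A by (intro lincomb_diagram_classes) (auto simp: A_def)
    also have "(\<Sum>Y\<in>A. cmul (Poly_Mapping.lookup w (f Y)) (Poly_Mapping.single (f Y) 1))
      = (\<Sum>\<delta>\<in>Poly_Mapping.keys w. cmul (Poly_Mapping.lookup w \<delta>) (Poly_Mapping.single \<delta> 1))"
      unfolding A_def using inj f by (simp add: sum.reindex)
    also have "\<dots> = w" by (rule monomial_expansion[symmetric])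
    also have "coset n k w = X" using w(2) unfolding v(2) by (simp only: coset_eq_iff[symmetric])
    finally show "X \<in> Q.span (outer_classes n k)"
      unfolding Q.span_def using A by (auto simp: laurent_ring_def)
  qed
qed

lemma outer_classes_basis: "Q.module_basis (outer_classes n k)"
  unfolding Q.module_basis_def
  using outer_classes_lin_indpt outer_classes_span outer_classes_carrier by blast

end

text \<open>The injectivity clause makes the basis indexed by the outer diagrams themselves and not
  only by the set of their classes.\<close>

theorem proposition4p4p4:
  fixes n k :: nat
  assumes "k \<le> n"
  shows "inj_on (diagram_class n k) (outer_diagrams n k) \<and>
    module.module_basis laurent_ring (quantum_russell_space n k) (outer_classes n k)"
  using diagram_class_inj outer_classes_basis by blast

end
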